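(* Let $S\subset\mathbb{R}^3$ be a smoothly embedded closed strictly convex surface. Then its tangent hypersurface $\mathcal{H}(S)\subset\mathbb{L}(\mathbb{R}^3)$ is null with respect to the neutral metric $\mathbb{G}$ and is foliated by null geodesic circles.
   Context: $\mathbb{L}(\mathbb{R}^3)$ is the space of oriented lines in $\mathbb{R}^3$, identified with $T\mathbb{S}^2$: with $\xi$ the standard holomorphic coordinate on $\mathbb{S}^2$ about the north pole, the tangent vector $\eta\,\partial_\xi+\bar\eta\,\partial_{\bar\xi}$ corresponds to the oriented line, parameterized by $r\in\mathbb{R}$, $$x^1+ix^2=\frac{2(\eta-\bar{\xi}^2\bar{\eta})}{(1+\xi\bar{\xi})^2}+\frac{2\xi}{1+\xi\bar{\xi}}r,\qquad x^3=-\frac{2(\xi\bar{\eta}+\bar{\xi}\eta)}{(1+\xi\bar{\xi})^2}+\frac{1-\xi\bar{\xi}}{1+\xi\bar{\xi}}r .$$ It carries the neutral (signature $(2,2)$) metric, invariant under the Euclidean group, $$\mathbb{G}=2(1+\xi\bar{\xi})^{-2}\,\mathrm{Im}\left(d\bar{\eta}\, d\xi+\frac{2\bar{\xi}\eta}{1+\xi\bar{\xi}}d\xi\, d\bar{\xi}\right).$$ The tangent hypersurface $\mathcal{H}(S)$ is the set of oriented lines tangent to $S$; for $S$ closed and strictly convex it is an embedded copy of the unit tangent bundle of $S$, a circle bundle over $S$. A hypersurface is null if its normal vector is null (equivalently the induced metric is degenerate). Null geodesics are geodesics of $\mathbb{G}$ with null tangent vectors.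
   Formalization: In the formula for the oriented line, η−ξ̄²η̄ is corrected to η−ξ²η̄ (as printed, distinct η at ξ=e^{iπ/4} give the same line); "strictly convex" means bounding a convex body with positive definite second fundamental form. *)

theory Defs
  imports "HOL-Analysis.Analysis"
begin

section \<open>Smooth maps and embedded submanifolds of Euclidean spaces\<close>

fun times_differentiable_on ::
    "nat \<Rightarrow> ('a::euclidean_space \<Rightarrow> 'b::euclidean_space) \<Rightarrow> 'a set \<Rightarrow> bool" where
  "times_differentiable_on 0 f U \<longleftrightarrow> continuous_on U f"
| "times_differentiable_on (Suc k) f U \<longleftrightarrow>
     (\<forall>x\<in>U. f differentiable (at x)) \<and>
     (\<forall>a. times_differentiable_on k (\<lambda>x. frechet_derivative f (at x) a) U)"

text \<open>On an open set \<open>U\<close>, this is the class \<open>C\<close>-infinity.\<close>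

definition smooth_on :: "('a::euclidean_space \<Rightarrow> 'b::euclidean_space) \<Rightarrow> 'a set \<Rightarrow> bool" where
  "smooth_on f U \<longleftrightarrow> (\<forall>k. times_differentiable_on k f U)"

definition local_parametrization ::
    "('k::euclidean_space \<Rightarrow> 'a::euclidean_space) \<Rightarrow> 'k set \<Rightarrow> 'a set \<Rightarrow> bool" where
  "local_parametrization \<phi> U M \<longleftrightarrow>
     open U \<and> smooth_on \<phi> U \<and> (\<forall>x\<in>U. inj (frechet_derivative \<phi> (at x))) \<and>
     openin (top_of_set M) (\<phi> ` U) \<and> (\<exists>\<psi>. homeomorphism U (\<phi> ` U) \<phi> \<psi>)"

text \<open>Smoothly embedded submanifolds without boundary; the type \<open>'k\<close> of the parameters
  fixes the dimension.\<close>

definition smooth_submanifold :: "'k::euclidean_space itself \<Rightarrow> 'a::euclidean_space set \<Rightarrow> bool" where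
  "smooth_submanifold T M \<longleftrightarrow>
     (\<forall>p\<in>M. \<exists>(\<phi>::'k \<Rightarrow> 'a) U. local_parametrization \<phi> U M \<and> p \<in> \<phi> ` U)"

definition tangent_space :: "'a::euclidean_space set \<Rightarrow> 'a \<Rightarrow> 'a set" where
  "tangent_space M p =
     {v. \<exists>c. c 0 = p \<and> (\<forall>\<^sub>F t in nhds 0. c t \<in> M) \<and> (c has_vector_derivative v) (at (0::real))}"

text \<open>Foliations of \<open>M\<close> with leaves of dimension \<open>DIM('p)\<close> and codimension \<open>DIM('q)\<close>:
  in a foliated chart the plaques are the components of the intersections with the leaves.\<close>

definition smooth_foliation ::
    "('p::euclidean_space \<times> 'q::euclidean_space) itself \<Rightarrow> 'a::euclidean_space set \<Rightarrow> 'a set set \<Rightarrow> bool" where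
  "smooth_foliation T M F \<longleftrightarrow>
     \<Union>F = M \<and> disjoint F \<and> (\<forall>C\<in>F. C \<noteq> {} \<and> path_connected C) \<and>
     (\<forall>x\<in>M. \<exists>(\<phi>::'p \<times> 'q \<Rightarrow> 'a) A B.
        local_parametrization \<phi> (A \<times> B) M \<and> connected A \<and> connected B \<and> x \<in> \<phi> ` (A \<times> B) \<and>
        (\<forall>C\<in>F. components (C \<inter> \<phi> ` (A \<times> B)) \<subseteq> {\<phi> ` (A \<times> {y}) | y. y \<in> B}))"


section \<open>Strictly convex surfaces\<close>

text \<open>\<open>S\<close> bounds a convex body, and at each point the second fundamental form
  with respect to some unit normal \<open>n\<close> (the inner one) is positive definite,
  i.e. both principal curvatures are positive.
  For a local parametrization \<open>\<phi>\<close> the second fundamental form has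
  the components \<open>n \<bullet> \<partial>\<^sub>i \<partial>\<^sub>j \<phi>\<close>.\<close>

definition strictly_convex_surface :: "(real^3) set \<Rightarrow> bool" where
  "strictly_convex_surface S \<longleftrightarrow>
     (\<exists>K. compact K \<and> convex K \<and> interior K \<noteq> {} \<and> S = frontier K) \<and>
     (\<forall>p\<in>S. \<exists>n. norm n = 1 \<and> (\<forall>v\<in>tangent_space S p. n \<bullet> v = 0) \<and>
        (\<forall>(\<phi>::real \<times> real \<Rightarrow> real^3) U x a.
           local_parametrization \<phi> U S \<and> x \<in> U \<and> \<phi> x = p \<and> a \<noteq> 0 \<longrightarrow>
           n \<bullet> frechet_derivative (\<lambda>y. frechet_derivative \<phi> (at y) a) (at x) a > 0))"


section \<open>The space of oriented lines\<close>

text \<open>The pair \<open>(u, v)\<close> is the line \<open>{v + r *\<^sub>R u | r}\<close> with direction \<open>u\<close>, where \<open>v\<close> is its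
  point closest to the origin.  Thus the space of oriented lines is the tangent bundle of the
  unit sphere.\<close>

definition oriented_lines :: "((real^3) \<times> (real^3)) set" where
  "oriented_lines = {(u, v). norm u = 1 \<and> u \<bullet> v = 0}"

definition tangent_hypersurface :: "(real^3) set \<Rightarrow> ((real^3) \<times> (real^3)) set" where
  "tangent_hypersurface S =
     {(u, v) \<in> oriented_lines. \<exists>r. v + r *\<^sub>R u \<in> S \<and> u \<in> tangent_space S (v + r *\<^sub>R u)}"

text \<open>The vector with \<open>x\<^sup>1 + i x\<^sup>2 = z\<close> and \<open>x\<^sup>3 = t\<close>.\<close>

definition point3 :: "complex \<Rightarrow> real \<Rightarrow> real^3" where
  "point3 z t = vector [Re z, Im z, t]"

text \<open>The coordinates \<open>(\<xi>, \<eta>)\<close> about the north pole, composed with a rotation \<open>R\<close>.  They miss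
  the lines with direction opposite to the pole, whence the need for several poles.  The second
  component is the derivative of the first one with respect to \<open>\<xi>\<close> in direction \<open>\<eta>\<close>.\<close>

definition line_chart :: "real^3^3 \<Rightarrow> complex \<times> complex \<Rightarrow> (real^3) \<times> (real^3)" where
  "line_chart R = (\<lambda>(\<xi>, \<eta>).
     (R *v point3 (2 * \<xi> / (1 + \<xi> * cnj \<xi>)) (Re ((1 - \<xi> * cnj \<xi>) / (1 + \<xi> * cnj \<xi>))),
      R *v point3 (2 * (\<eta> - \<xi>\<^sup>2 * cnj \<eta>) / (1 + \<xi> * cnj \<xi>)\<^sup>2)
                  (Re (- 2 * (\<xi> * cnj \<eta> + cnj \<xi> * \<eta>) / (1 + \<xi> * cnj \<xi>)\<^sup>2))))"


section \<open>The neutral metric\<close>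

text \<open>The symmetric bilinear form with the quadratic form
  \<open>2 (1 + \<xi>\<xi>\<^sup>*)\<^sup>-\<^sup>2 Im (d\<eta>\<^sup>* d\<xi> + 2 \<xi>\<^sup>* \<eta> / (1 + \<xi>\<xi>\<^sup>*) d\<xi> d\<xi>\<^sup>*)\<close>.\<close>

definition chart_metric :: "complex \<times> complex \<Rightarrow> complex \<times> complex \<Rightarrow> complex \<times> complex \<Rightarrow> real" where
  "chart_metric = (\<lambda>(\<xi>, \<eta>) (d\<xi>\<^sub>1, d\<eta>\<^sub>1) (d\<xi>\<^sub>2, d\<eta>\<^sub>2).
     Im ((cnj d\<eta>\<^sub>1 * d\<xi>\<^sub>2 + cnj d\<eta>\<^sub>2 * d\<xi>\<^sub>1
          + 2 * cnj \<xi> * \<eta> / (1 + \<xi> * cnj \<xi>) * (d\<xi>\<^sub>1 * cnj d\<xi>\<^sub>2 + d\<xi>\<^sub>2 * cnj d\<xi>\<^sub>1))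
         / (1 + \<xi> * cnj \<xi>)\<^sup>2))"

definition pullback_metric ::
    "('b::euclidean_space \<Rightarrow> 'b \<Rightarrow> 'b \<Rightarrow> real) \<Rightarrow> ('a::euclidean_space \<Rightarrow> 'b) \<Rightarrow> 'a \<Rightarrow> 'a \<Rightarrow> 'a \<Rightarrow> real" where
  "pullback_metric g \<phi> x a b =
     g (\<phi> x) (frechet_derivative \<phi> (at x) a) (frechet_derivative \<phi> (at x) b)"

text \<open>The invariant metric on tangent vectors \<open>X\<close>, \<open>Y\<close> at the line \<open>l\<close>: its expression is the same in
  the coordinates about any pole (see \<open>pullback_neutral_metric\<close> below).\<close>

definition neutral_metric ::
    "(real^3) \<times> (real^3) \<Rightarrow> (real^3) \<times> (real^3) \<Rightarrow> (real^3) \<times> (real^3) \<Rightarrow> real" where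
  "neutral_metric l X Y = (THE s. \<exists>R z a b.
     rotation_matrix R \<and> l = line_chart R z \<and>
     X = frechet_derivative (line_chart R) (at z) a \<and>
     Y = frechet_derivative (line_chart R) (at z) b \<and>
     s = chart_metric z a b)"

text \<open>The normal vectors of a hypersurface at a point form a line, so it does not matter which
  normal vector \<open>N \<noteq> 0\<close> is tested.\<close>

definition null_hypersurface :: "((real^3) \<times> (real^3)) set \<Rightarrow> bool" where
  "null_hypersurface M \<longleftrightarrow>
     M \<subseteq> oriented_lines \<and> smooth_submanifold TYPE(real \<times> real \<times> real) M \<and>
     (\<forall>l\<in>M. \<exists>N\<in>tangent_space oriented_lines l. N \<noteq> 0 \<and>
        (\<forall>X\<in>tangent_space M l. neutral_metric l N X = 0) \<and> neutral_metric l N N = 0)"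


section \<open>Geodesics\<close>

text \<open>\<open>christoffel g x v w\<close> is the vector with components
  \<open>\<Gamma>\<^sup>k\<^sub>i\<^sub>j v\<^sup>i w\<^sup>j\<close> for a pseudo-Riemannian metric \<open>g\<close> in coordinates.\<close>

definition christoffel :: "('a::euclidean_space \<Rightarrow> 'a \<Rightarrow> 'a \<Rightarrow> real) \<Rightarrow> 'a \<Rightarrow> 'a \<Rightarrow> 'a \<Rightarrow> 'a" where
  "christoffel g x v w = (THE y. \<forall>z. g x y z =
     (frechet_derivative (\<lambda>x. g x w z) (at x) v
      + frechet_derivative (\<lambda>x. g x v z) (at x) w
      - frechet_derivative (\<lambda>x. g x v w) (at x) z) / 2)"

definition line_geodesic :: "(real \<Rightarrow> (real^3) \<times> (real^3)) \<Rightarrow> bool" where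
  "line_geodesic \<gamma> \<longleftrightarrow>
     range \<gamma> \<subseteq> oriented_lines \<and>
     (\<forall>R t. rotation_matrix R \<and> \<gamma> t \<in> range (line_chart R) \<longrightarrow>
       (\<exists>c c' c''.
          (\<forall>\<^sub>F s in nhds t. \<gamma> s = line_chart R (c s) \<and> (c has_vector_derivative c' s) (at s)) \<and>
          (c' has_vector_derivative c'') (at t) \<and>
          c'' + christoffel (pullback_metric neutral_metric (line_chart R)) (c t) (c' t) (c' t) = 0))"

definition null_geodesic_circle :: "((real^3) \<times> (real^3)) set \<Rightarrow> bool" where
  "null_geodesic_circle C \<longleftrightarrow>
     (\<exists>\<gamma> P. line_geodesic \<gamma> \<and>
        (\<forall>t. vector_derivative \<gamma> (at t) \<noteq> 0 \<and>
             neutral_metric (\<gamma> t) (vector_derivative \<gamma> (at t)) (vector_derivative \<gamma> (at t)) = 0) \<and>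
        P > 0 \<and> (\<forall>t. \<gamma> (t + P) = \<gamma> t) \<and> inj_on \<gamma> {0..<P} \<and> C = range \<gamma>)"


section \<open>Well-definedness of the neutral metric\<close>

text \<open>The number \<open>s\<close> in the definition of \<open>neutral_metric\<close> is unique, since with triple products in
  \<open>\<real>\<^sup>3\<close> the metric is \<open>- (u \<bullet> (u\<^sub>1 \<times> v\<^sub>2) + u \<bullet> (u\<^sub>2 \<times> v\<^sub>1)) / 4\<close> for
  tangent vectors \<open>(u\<^sub>1, v\<^sub>1)\<close> and \<open>(u\<^sub>2, v\<^sub>2)\<close> at \<open>(u, v)\<close>.\<close>

context
begin

private lemma point3_alt: "point3 z t = Re z *\<^sub>R axis 1 1 + Im z *\<^sub>R axis 2 1 + t *\<^sub>R axis 3 1"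
  by (simp add: point3_def vec_eq_iff forall_3 axis_def)

private lemma has_derivative_point3: "(f has_derivative f') F \<Longrightarrow> (g has_derivative g') F \<Longrightarrow>
  ((\<lambda>x. point3 (f x) (g x)) has_derivative (\<lambda>h. point3 (f' h) (g' h))) F"
  unfolding point3_alt
  by (intro has_derivative_add has_derivative_scaleR_left has_derivative_Re has_derivative_Im)

private definition "denom \<xi> = 1 + (Re \<xi>)\<^sup>2 + (Im \<xi>)\<^sup>2"

private lemma denom: "1 + \<xi> * cnj \<xi> = of_real (denom \<xi>)" "1 - \<xi> * cnj \<xi> = of_real (2 - denom \<xi>)"
  by (auto simp: denom_def complex_eq_iff power2_eq_square)
private lemma denom_pos: "denom \<xi> > 0" unfolding denom_def by (smt (verit) zero_le_power2)

private definition "dir_num \<xi> = point3 (2 * \<xi>) (2 - denom \<xi>)"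
private definition "foot_num = (\<lambda>(\<xi>,\<eta>). point3 (2 * (\<eta> - \<xi>\<^sup>2 * cnj \<eta>)) (Re(- 2 * (\<xi> * cnj \<eta>
      + cnj \<xi> * \<eta>))))"

private definition "inv_denom \<xi> = inverse (denom \<xi>)"

private lemma divide_denom: "c / complex_of_real (denom \<xi>) = inv_denom \<xi> *\<^sub>R c"
    "c / (complex_of_real (denom \<xi>))^2 = (inv_denom \<xi>)^2 *\<^sub>R c"
    by (simp_all add: scaleR_conv_of_real divide_inverse mult.commute power_inverse inv_denom_def)

private lemma point3_scale: "point3 (c *\<^sub>R z) (c * t) = c *\<^sub>R point3 z t"
  by (simp add: point3_def vec_eq_iff forall_3)

private lemma line_chart_alt: "line_chart R
      = (\<lambda>z. (R *v (inv_denom (fst z) *\<^sub>R dir_num (fst z)), R *v ((inv_denom (fst z))^2 *\<^sub>R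
      foot_num z)))"
  unfolding line_chart_def fun_eq_iff denom divide_denom dir_num_def foot_num_def
    scaleR_complex.sel point3_scale Re_complex_of_real
  by (simp only: split_paired_All case_prod_conv fst_conv snd_conv simp_thms)

private definition "denom_deriv \<xi> a = 2 * (Re \<xi> * Re a + Im \<xi> * Im a)"
private definition "dir_deriv \<xi> a = point3 (2 * a) (- denom_deriv \<xi> a)"
private definition "foot_deriv = (\<lambda>(\<xi>,\<eta>) (a,b). point3 (2 * (b - \<xi>\<^sup>2 * cnj b
      - 2 * \<xi> * a * cnj \<eta>)) (Re(- 2 * (a * cnj \<eta> + \<xi> * cnj b + cnj a * \<eta> + cnj \<xi> * b))))"

private lemma has_derivative_denom: "(denom has_derivative denom_deriv \<xi>) (at \<xi>)"
  unfolding denom_def denom_deriv_def by (auto intro!: derivative_eq_intros simp: algebra_simps)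

private lemma has_derivative_dir_num: "(dir_num has_derivative dir_deriv \<xi>) (at \<xi>)"
  unfolding dir_num_def dir_deriv_def
  by (rule has_derivative_point3) (auto intro!: derivative_eq_intros has_derivative_denom)

private lemma has_derivative_foot_num: "(foot_num has_derivative foot_deriv z) (at z)"
  unfolding foot_num_def foot_deriv_def case_prod_beta
  by (rule has_derivative_point3) (auto intro!: derivative_eq_intros simp: algebra_simps)

private definition "inv_denom_deriv \<xi> a = - (denom_deriv \<xi> a) / (denom \<xi>)^2"

private lemma has_derivative_inv_denom: "(inv_denom has_derivative inv_denom_deriv \<xi>) (at \<xi>)"
  using denom_pos[of \<xi>] unfolding inv_denom_deriv_def inv_denom_def
  by (auto intro!: derivative_eq_intros has_derivative_denom simp: fun_eq_iff field_simps
      power2_eq_square)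

private definition "chart_deriv z a = (inv_denom_deriv (fst z) (fst a) *\<^sub>R dir_num (fst z)
      + inv_denom (fst z) *\<^sub>R dir_deriv (fst z) (fst a),
   (2 * inv_denom (fst z) * inv_denom_deriv (fst z) (fst a)) *\<^sub>R foot_num z
      + (inv_denom (fst z))^2 *\<^sub>R foot_deriv z a)"

private lemma has_derivative_line_chart: "(line_chart R
      has_derivative (\<lambda>a. (R *v fst (chart_deriv z a), R *v snd (chart_deriv z a)))) (at z)"
proof -
  note f = has_derivative_fst[OF has_derivative_ident]
  note d = has_derivative_compose[OF f has_derivative_inv_denom] has_derivative_compose[OF f
      has_derivative_dir_num] has_derivative_foot_num
  show ?thesis
  unfolding line_chart_alt chart_deriv_def fst_conv snd_conv
  by (rule has_derivative_Pair; rule bounded_linear.has_derivative[OF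
      matrix_vector_mul_bounded_linear])
   (auto intro!: derivative_eq_intros d simp: algebra_simps)
qed

private lemma triple_product_rotation: assumes "rotation_matrix R" shows "(R *v x)
      \<bullet> cross3 (R *v y) (R *v z) = x \<bullet> cross3 y z"
proof -
  have "orthogonal_transformation ((*v) R)"
    using assms by (simp add: rotation_matrix_def orthogonal_transformation_matrix)
  then show ?thesis using assms
    by (simp add: cross_rotation_matrix orthogonal_transformation_def)
qed

private lemma triple_product_expand:
  fixes A B A1 A2 B1 B2 :: "real^3"
  shows "(m *\<^sub>R A) \<bullet> cross3 ((-d1*m^2) *\<^sub>R A + m *\<^sub>R A1) ((2*m*(-d2*m^2)) *\<^sub>R B + m^2 *\<^sub>R B2)
    = m^4 * (A \<bullet> cross3 A1 B2 - 2 * m * d2 * (A \<bullet> cross3 A1 B))"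
  by (simp add: cross3_def inner_vec_def sum_3) algebra

private lemma triple_product_polynomial:
  assumes "s = denom (fst z)"
  shows "s * (dir_num (fst z) \<bullet> cross3 (dir_deriv (fst z) (fst a)) (foot_deriv z b))
      - 2 * denom_deriv (fst z) (fst b) * (dir_num (fst z)
      \<bullet> cross3 (dir_deriv (fst z) (fst a)) (foot_num z))
   + (s * (dir_num (fst z) \<bullet> cross3 (dir_deriv (fst z) (fst b)) (foot_deriv z a))
      - 2 * denom_deriv (fst z) (fst a) * (dir_num (fst z)
      \<bullet> cross3 (dir_deriv (fst z) (fst b)) (foot_num z)))
   = - 4 * s^2 * (s * Im (cnj (snd a) * fst b + cnj (snd b) * fst a) +
     Im (2 * cnj (fst z) * snd z * (fst a * cnj (fst b) + fst b * cnj (fst a))))"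
proof -
  obtain x y h k a1 a2 a3 a4 b1 b2 b3 b4 where [simp]: "z = (Complex x y, Complex h k)"
     "a = (Complex a1 a2, Complex a3 a4)" "b = (Complex b1 b2, Complex b3 b4)"
    by (metis complex.exhaust prod.exhaust)
  show ?thesis unfolding assms
    by (simp add: dir_num_def foot_num_def dir_deriv_def foot_deriv_def denom_deriv_def
        point3_def cross3_def inner_vec_def sum_3 denom_def power2_eq_square) algebra
qed

private lemma chart_metric_triple_product: "chart_metric z a b =
      - ((inv_denom (fst z) *\<^sub>R dir_num (fst z))
      \<bullet> cross3 (fst (chart_deriv z a)) (snd (chart_deriv z b))
   + (inv_denom (fst z) *\<^sub>R dir_num (fst z))
      \<bullet> cross3 (fst (chart_deriv z b)) (snd (chart_deriv z a))) / 4"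
proof -
  define m where "m = inv_denom (fst z)"
  define s where "s = denom (fst z)"
  have m: "m * s = 1" using denom_pos[of "fst z"] by (simp add: m_def inv_denom_def s_def)
  have ch: "chart_metric z a b = m^2 * Im (cnj (snd a) * fst b + cnj (snd b) * fst a) +
     m^3 * Im (2 * cnj (fst z) * snd z * (fst a * cnj (fst b) + fst b * cnj (fst a)))"
    unfolding chart_metric_def case_prod_beta denom divide_denom m_def
    by (simp add: algebra_simps power2_eq_square power3_eq_cube)
  have dr: "inv_denom_deriv (fst z) a = - denom_deriv (fst z) a * m^2" for a
    by (simp add: inv_denom_deriv_def m_def inv_denom_def divide_inverse power_inverse)
  let ?P = "dir_num (fst z) \<bullet> cross3 (dir_deriv (fst z) (fst a)) (foot_deriv z b)" and ?P'
      = "dir_num (fst z) \<bullet> cross3 (dir_deriv (fst z) (fst b)) (foot_deriv z a)"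
  let ?Q = "denom_deriv (fst z) (fst b) * (dir_num (fst z)
      \<bullet> cross3 (dir_deriv (fst z) (fst a)) (foot_num z))"
    and ?Q' = "denom_deriv (fst z) (fst a) * (dir_num (fst z)
      \<bullet> cross3 (dir_deriv (fst z) (fst b)) (foot_num z))"
  define I where "I = Im (cnj (snd a) * fst b + cnj (snd b) * fst a)"
  define J where "J = Im (2 * cnj (fst z) * snd z * (fst a * cnj (fst b) + fst b * cnj (fst a)))"
  have "s * ?P - 2 * ?Q + (s * ?P' - 2 * ?Q') = -4 * s^2*(s * I + J)"
    using triple_product_polynomial[OF s_def, of a b] by (simp add: I_def J_def mult.assoc)
  then have "m^4 * (?P - 2*m*?Q + (?P' - 2*m*?Q')) = -4 * (m^2 * I + m^3 * J)"
    using m by algebra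
  then show ?thesis unfolding ch chart_deriv_def fst_conv snd_conv m_def[symmetric] dr
      triple_product_expand
     I_def[symmetric] J_def[symmetric] by (simp add: algebra_simps)
qed

lemma chart_metric_eq:
  assumes "rotation_matrix R"
  shows "chart_metric z a b = - (fst (line_chart R z)
      \<bullet> cross3 (fst (frechet_derivative (line_chart R) (at z) a)) (snd (frechet_derivative
      (line_chart R) (at z) b))
    + fst (line_chart R z) \<bullet> cross3 (fst (frechet_derivative (line_chart R) (at z) b)) (snd
      (frechet_derivative (line_chart R) (at z) a))) / 4"
proof -
  have f: "fst (line_chart R z) = R *v (inv_denom (fst z) *\<^sub>R dir_num (fst z))" by (simp add:
      line_chart_alt)
  show ?thesis
    unfolding frechet_derivative_at[OF has_derivative_line_chart, symmetric] fst_conv snd_conv f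
      triple_product_rotation[OF assms] by (rule chart_metric_triple_product)
qed

lemma pullback_neutral_metric:
  "rotation_matrix R \<Longrightarrow> pullback_metric neutral_metric (line_chart R) = chart_metric"
  unfolding pullback_metric_def neutral_metric_def fun_eq_iff
  by (intro allI the_equality) (blast, metis chart_metric_eq)

end

end

theory Submission
  imports Defs
begin

text \<open>
  The lines that are tangent to \<open>S\<close> at a fixed point \<open>p\<close> form a pencil: their directions \<open>u\<close> run through
  a great circle and their foot points are \<open>p - (p \<bullet> u) u\<close>.  These pencils are the leaves of the foliation.

  \<^emph>\<open>The hypersurface is null.\<close>  At the line \<open>(u, v)\<close>, the product of the tangent vectors
  \<open>(u\<^sub>1, v\<^sub>1)\<close> and \<open>(u\<^sub>2, v\<^sub>2)\<close> is \<open>- (u \<bullet> (u\<^sub>1 \<times> v\<^sub>2) + u \<bullet> (u\<^sub>2 \<times> v\<^sub>1)) / 4\<close>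
  (\<open>neutral_metric_triple_product\<close>).  Let \<open>N\<close> be the velocity of the pencil at \<open>p\<close>, where \<open>S\<close> has the unit
  normal \<open>n\<close>, and let \<open>X\<close> be the velocity of any curve of tangent lines.  Then the product of \<open>N\<close> and
  \<open>X\<close> is \<open>- (n \<bullet> d) / 4\<close>, where \<open>d\<close> is the velocity of a point that starts at \<open>p\<close> and moves with the
  line.  Tangent lines of the boundary of a convex body avoid its interior, and a point that leaves \<open>p\<close> with
  a velocity that is not tangent to \<open>S\<close> would be in the interior shortly before or after
  (\<open>velocity_tangent_if_avoids_interior\<close>).  Hence \<open>n \<bullet> d = 0\<close>, so \<open>N\<close> is a normal vector of the
  hypersurface.  It is tangent to the hypersurface as well, so it is null (\<open>null_normal\<close>).

  \<^emph>\<open>Pencils are geodesics.\<close>  In coordinates, the first geodesic equation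
  \<open>\<xi>'' = 2 \<xi>\<^sup>* \<xi>'\<^sup>2 / (1 + \<xi>\<xi>\<^sup>*)\<close> says that the direction runs through a great circle with constant speed.
  For a pencil, \<open>\<eta> = f \<xi>'\<close> with \<open>f\<close> given by the components of \<open>p\<close> along the velocity of the direction
  and along the normal of the pencil, since stereographic projection is conformal.  As \<open>f'' = - Re f\<close>,
  the second geodesic equation follows from the first one (\<open>christoffel_pencil\<close>,
  \<open>pencil_line_geodesic\<close>).

  \<^emph>\<open>The pencils form a foliation.\<close>  Positive definiteness of the second fundamental form is used
  twice.  It makes \<open>p\<close> a strict local minimum of the height above the tangent plane, so a line touches
  \<open>S\<close> in one point only and the pencils are disjoint (\<open>unique_tangency_point\<close>).  The point of tangency
  is then a continuous function of the line, because its graph is closed and \<open>S\<close> is compact.  Definiteness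
  also shows that the parametrization of the tangent lines by a point \<open>\<phi> y\<close> and a direction
  \<open>\<partial>\<^sub>a \<phi> + s \<partial>\<^sub>b \<phi>\<close> has an injective derivative (\<open>inj_derivative\<close>).  In this chart the pencils are the
  slices of constant \<open>y\<close>.
\<close>

section \<open>Closure properties of smooth maps\<close>

lemma times_differentiable_on_cong:
  assumes "open U" "\<And>x. x \<in> U \<Longrightarrow> f x = g x"
  shows "times_differentiable_on k f U \<longleftrightarrow> times_differentiable_on k g U"
  using assms(2)
proof (induction k arbitrary: f g)
  case 0
  then show ?case by (auto cong: continuous_on_cong)
next
  case (Suc k)
  have D: "(f has_derivative D) (at x) \<longleftrightarrow> (g has_derivative D) (at x)" if "x \<in> U" for x D
    using Suc.prems has_derivative_transform_within_open[OF _ assms(1) that, of f D UNIV g]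
      has_derivative_transform_within_open[OF _ assms(1) that, of g D UNIV f]
    by metis
  have E: "frechet_derivative f (at x) = frechet_derivative g (at x)" if "x \<in> U" for x
    unfolding frechet_derivative_def D[OF that] ..
  have "times_differentiable_on k (\<lambda>x. frechet_derivative f (at x) a) U \<longleftrightarrow>
        times_differentiable_on k (\<lambda>x. frechet_derivative g (at x) a) U" for a
    by (intro Suc.IH) (simp add: E)
  moreover have "f differentiable (at x) \<longleftrightarrow> g differentiable (at x)" if "x \<in> U" for x
    unfolding differentiable_def D[OF that] ..
  ultimately show ?case by simp
qed

text \<open>The induction step for all closure properties below: it suffices to exhibit a derivative
  whose values are \<open>k\<close> times differentiable.\<close>

lemma times_differentiable_on_SucI:
  assumes "open U" "\<And>x. x \<in> U \<Longrightarrow> (f has_derivative D x) (at x)"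
    and "\<And>a. times_differentiable_on k (\<lambda>x. D x a) U"
  shows "times_differentiable_on (Suc k) f U"
proof -
  have "frechet_derivative f (at x) = D x" if "x \<in> U" for x
    using frechet_derivative_at[OF assms(2)[OF that]] by simp
  then have "times_differentiable_on k (\<lambda>x. frechet_derivative f (at x) a) U" for a
    using assms(3) by (subst times_differentiable_on_cong[OF assms(1), where g = "\<lambda>x. D x a"]) auto
  then show ?thesis using assms(2) by (auto simp: differentiable_def)
qed

lemma times_differentiable_on_SucD:
  assumes "times_differentiable_on (Suc k) f U"
  shows "x \<in> U \<Longrightarrow> (f has_derivative frechet_derivative f (at x)) (at x)"
    and "times_differentiable_on k (\<lambda>x. frechet_derivative f (at x) a) U"
  using assms frechet_derivative_works by auto

lemma times_differentiable_on_Suc_imp: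
  "times_differentiable_on (Suc k) f U \<Longrightarrow> times_differentiable_on k f U"
proof (induction k arbitrary: f)
  case 0
  then show ?case
    by (auto intro!: continuous_at_imp_continuous_on differentiable_imp_continuous_within)
next
  case (Suc k)
  then show ?case by (metis times_differentiable_on.simps(2))
qed

lemma times_differentiable_on_subset:
  "times_differentiable_on k f U \<Longrightarrow> V \<subseteq> U \<Longrightarrow> times_differentiable_on k f V"
  by (induction k arbitrary: f) (auto intro: continuous_on_subset)

lemma times_differentiable_on_const: "times_differentiable_on k (\<lambda>x. c) U"
  by (induction k arbitrary: c) auto

lemma times_differentiable_on_linear:
  assumes "open U" "bounded_linear h"
  shows "times_differentiable_on k h U"
proof (cases k)
  case 0
  then show ?thesis using assms by (simp add: linear_continuous_on)
next
  case (Suc m)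
  show ?thesis unfolding Suc
    by (rule times_differentiable_on_SucI[where D = "\<lambda>x. h"])
      (use assms in \<open>auto intro: bounded_linear_imp_has_derivative times_differentiable_on_const\<close>)
qed

lemma times_differentiable_on_linear_compose:
  assumes "open U" "bounded_linear h"
  shows "times_differentiable_on k f U \<Longrightarrow> times_differentiable_on k (\<lambda>x. h (f x)) U"
proof (induction k arbitrary: f)
  case 0
  then show ?case using bounded_linear.continuous_on[OF assms(2)] by auto
next
  case (Suc k)
  show ?case
    by (rule times_differentiable_on_SucI[OF assms(1)])
      (use Suc times_differentiable_on_SucD bounded_linear.has_derivative[OF assms(2)]
        in blast)+
qed

lemma times_differentiable_on_add:
  assumes "open U"
  shows "times_differentiable_on k f U \<Longrightarrow> times_differentiable_on k g U \<Longrightarrow>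
    times_differentiable_on k (\<lambda>x. f x + g x) U"
proof (induction k arbitrary: f g)
  case 0
  then show ?case by (auto intro: continuous_intros)
next
  case (Suc k)
  show ?case
    by (rule times_differentiable_on_SucI[OF assms])
      (use Suc times_differentiable_on_SucD in \<open>blast intro: has_derivative_add\<close>)+
qed

lemma times_differentiable_on_bilinear:
  assumes "open U" "bounded_bilinear h"
  shows "times_differentiable_on k f U \<Longrightarrow> times_differentiable_on k g U \<Longrightarrow>
    times_differentiable_on k (\<lambda>x. h (f x) (g x)) U"
proof (induction k arbitrary: f g)
  case 0
  then show ?case using bounded_bilinear.continuous_on[OF assms(2)] by auto
next
  case (Suc k)
  show ?case
  proof (rule times_differentiable_on_SucI[OF assms(1)])
    show "((\<lambda>x. h (f x) (g x)) has_derivative (\<lambda>a. h (f x) (frechet_derivative g (at x) a)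
        + h (frechet_derivative f (at x) a) (g x))) (at x)" if "x \<in> U" for x
      using bounded_bilinear.FDERIV[OF assms(2) times_differentiable_on_SucD(1)[OF Suc.prems(1) that]
          times_differentiable_on_SucD(1)[OF Suc.prems(2) that]] .
    show "times_differentiable_on k (\<lambda>x. h (f x) (frechet_derivative g (at x) a)
        + h (frechet_derivative f (at x) a) (g x)) U" for a
      by (intro times_differentiable_on_add[OF assms(1)] Suc.IH
          times_differentiable_on_Suc_imp[OF Suc.prems(1)] times_differentiable_on_SucD(2)[OF Suc.prems(1)]
          times_differentiable_on_Suc_imp[OF Suc.prems(2)] times_differentiable_on_SucD(2)[OF Suc.prems(2)])
  qed
qed

lemma times_differentiable_on_compose_linear:
  assumes "open U" "bounded_linear l" "l ` V \<subseteq> U" "open V"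
  shows "times_differentiable_on k f U \<Longrightarrow> times_differentiable_on k (\<lambda>x. f (l x)) V"
proof (induction k arbitrary: f)
  case 0
  then show ?case using assms continuous_on_compose2[of U f V l]
    by (simp add: linear_continuous_on)
next
  case (Suc k)
  show ?case
  proof (rule times_differentiable_on_SucI[OF assms(4)])
    show "((\<lambda>x. f (l x)) has_derivative (\<lambda>a. frechet_derivative f (at (l x)) (l a))) (at x)"
      if "x \<in> V" for x
      using has_derivative_compose[OF bounded_linear_imp_has_derivative[OF assms(2)], of f _ x UNIV]
        times_differentiable_on_SucD(1)[OF Suc.prems, of "l x"] that assms(3) by auto
    show "times_differentiable_on k (\<lambda>x. frechet_derivative f (at (l x)) (l a)) V" for a
      using Suc.IH[OF times_differentiable_on_SucD(2)[OF Suc.prems]] .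
  qed
qed

text \<open>The class is closed under \<open>1 / \<parallel>w\<parallel>\<close> because the derivative
  \<open>- (w \<bullet> dw) / \<parallel>w\<parallel>\<^sup>3\<close> is a polynomial in \<open>w\<close>, \<open>dw\<close> and \<open>1 / \<parallel>w\<parallel>\<close> itself.\<close>

lemma times_differentiable_on_inverse_norm:
  assumes "open U" "\<And>x. x \<in> U \<Longrightarrow> w x \<noteq> 0"
  shows "times_differentiable_on k w U \<Longrightarrow> times_differentiable_on k (\<lambda>x. inverse (norm (w x))) U"
proof (induction k)
  case 0
  then show ?case using assms(2) by (auto intro!: continuous_intros)
next
  case (Suc k)
  show ?case
  proof (rule times_differentiable_on_SucI[OF assms(1)])
    let ?i = "\<lambda>x. inverse (norm (w x))"
    show "(?i has_derivative (\<lambda>a. - 1 *\<^sub>R ((w x \<bullet> frechet_derivative w (at x) a) *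
        (?i x * (?i x * ?i x))))) (at x)" if "x \<in> U" for x
    proof -
      have w: "(w has_derivative frechet_derivative w (at x)) (at x)"
        using times_differentiable_on_SucD(1)[OF Suc.prems that] .
      have "norm (w x) \<noteq> 0" using assms(2)[OF that] by simp
      then show ?thesis
        by (auto intro!: derivative_eq_intros has_derivative_compose[OF w has_derivative_norm] w
            simp: sgn_div_norm assms(2)[OF that] inner_commute field_simps)
    qed
    have i: "times_differentiable_on k ?i U"
      using Suc.IH times_differentiable_on_Suc_imp[OF Suc.prems] .
    show "times_differentiable_on k (\<lambda>x. - 1 *\<^sub>R ((w x \<bullet> frechet_derivative w (at x) a) *
        (?i x * (?i x * ?i x)))) U" for a
      by (intro times_differentiable_on_bilinear[OF assms(1) bounded_bilinear_scaleR]
          times_differentiable_on_bilinear[OF assms(1) bounded_bilinear_mult]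
          times_differentiable_on_bilinear[OF assms(1) bounded_bilinear_inner]
          times_differentiable_on_const i times_differentiable_on_Suc_imp[OF Suc.prems]
          times_differentiable_on_SucD(2)[OF Suc.prems])
  qed
qed

lemma smooth_on_subset: "smooth_on f U \<Longrightarrow> V \<subseteq> U \<Longrightarrow> smooth_on f V"
  unfolding smooth_on_def using times_differentiable_on_subset by blast

lemma smooth_on_derivative: "smooth_on f U \<Longrightarrow> smooth_on (\<lambda>x. frechet_derivative f (at x) a) U"
  unfolding smooth_on_def using times_differentiable_on_SucD(2) by blast

lemma smooth_on_has_derivative:
  "smooth_on f U \<Longrightarrow> x \<in> U \<Longrightarrow> (f has_derivative frechet_derivative f (at x)) (at x)"
  unfolding smooth_on_def using times_differentiable_on_SucD(1) by blast

lemma smooth_on_imp_continuous_on: "smooth_on f U \<Longrightarrow> continuous_on U f"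
  unfolding smooth_on_def using times_differentiable_on.simps(1) by blast

lemma smooth_on_linear: "open U \<Longrightarrow> bounded_linear h \<Longrightarrow> smooth_on h U"
  unfolding smooth_on_def using times_differentiable_on_linear by blast

lemma smooth_on_add:
  "open U \<Longrightarrow> smooth_on f U \<Longrightarrow> smooth_on g U \<Longrightarrow> smooth_on (\<lambda>x. f x + g x) U"
  unfolding smooth_on_def using times_differentiable_on_add by blast

lemma smooth_on_bilinear:
  "open U \<Longrightarrow> bounded_bilinear h \<Longrightarrow> smooth_on f U \<Longrightarrow> smooth_on g U \<Longrightarrow>
    smooth_on (\<lambda>x. h (f x) (g x)) U"
  unfolding smooth_on_def using times_differentiable_on_bilinear by blast

lemma smooth_on_compose_linear:
  "open U \<Longrightarrow> bounded_linear l \<Longrightarrow> l ` V \<subseteq> U \<Longrightarrow> open V \<Longrightarrow> smooth_on f U \<Longrightarrow>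
    smooth_on (\<lambda>x. f (l x)) V"
  unfolding smooth_on_def using times_differentiable_on_compose_linear by blast

lemma smooth_on_inverse_norm:
  "open U \<Longrightarrow> (\<And>x. x \<in> U \<Longrightarrow> w x \<noteq> 0) \<Longrightarrow> smooth_on w U \<Longrightarrow>
    smooth_on (\<lambda>x. inverse (norm (w x))) U"
  unfolding smooth_on_def using times_differentiable_on_inverse_norm by blast

lemma smooth_on_linear_compose:
  "open U \<Longrightarrow> bounded_linear h \<Longrightarrow> smooth_on f U \<Longrightarrow> smooth_on (\<lambda>x. h (f x)) U"
  unfolding smooth_on_def using times_differentiable_on_linear_compose by blast

lemma smooth_on_diff:
  assumes "open U" "smooth_on f U" "smooth_on g U"
  shows "smooth_on (\<lambda>x. f x - g x) U"
  using smooth_on_add[OF assms(1,2) smooth_on_linear_compose[OF assms(1) _ assms(3)],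
      OF bounded_linear_minus[OF bounded_linear_ident]] by simp

lemma smooth_on_Pair:
  assumes "open U" "smooth_on f U" "smooth_on g U"
  shows "smooth_on (\<lambda>x. (f x, g x)) U"
proof -
  have "bounded_linear (\<lambda>y. (y, 0))" "bounded_linear (\<lambda>y. (0, y))"
    by (auto intro!: bounded_linear_intros)
  then have "smooth_on (\<lambda>x. (f x, 0) + (0, g x)) U"
    using assms by (intro smooth_on_add) (auto dest: smooth_on_linear_compose)
  then show ?thesis by simp
qed


section \<open>Stereographic coordinates of a line\<close>

text \<open>The inverse of the coordinates of lines about the north pole, for the direction \<open>w\<close> and the foot
  point \<open>y\<close>: the first coordinate is the stereographic projection of \<open>w\<close>, and the second one is the
  derivative of this projection at \<open>w\<close> in direction \<open>y\<close>.\<close>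

definition line_coords :: "(real^3) \<times> (real^3) \<Rightarrow> complex \<times> complex" where
  "line_coords = (\<lambda>(w, y). (Complex (w$1) (w$2) / of_real (1 + w$3),
     Complex (y$1) (y$2) / of_real (1 + w$3) - Complex (w$1) (w$2) * of_real (y$3) / (of_real (1 + w$3))\<^sup>2))"

lemma rotation_matrix_inverse:
  fixes R :: "real^'n^'n" and x y :: "real^'n"
  assumes "rotation_matrix R"
  shows "R *v (x v* R) = x" "(R *v x) v* R = x" "(x v* R) \<bullet> (y v* R) = x \<bullet> y"
proof -
  have R: "R ** transpose R = mat 1" "transpose R ** R = mat 1"
    using assms by (auto simp: rotation_matrix_def orthogonal_matrix_def)
  show 1: "R *v (x v* R) = x" for x
    using R by (metis matrix_vector_mul_assoc matrix_vector_mul_lid transpose_matrix_vector)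
  show "(R *v x) v* R = x"
    using R by (metis matrix_vector_mul_assoc matrix_vector_mul_lid transpose_matrix_vector)
  have "(x v* R) \<bullet> (y v* R) = x \<bullet> (R *v (y v* R))"
    by (rule dot_lmul_matrix)
  then show "(x v* R) \<bullet> (y v* R) = x \<bullet> y"
    by (simp only: 1)
qed

lemma one_plus_square_cnj:
  fixes \<xi> :: complex
  shows "1 + \<xi> * cnj \<xi> = of_real (1 + (cmod \<xi>)\<^sup>2)" "1 - \<xi> * cnj \<xi> = of_real (1 - (cmod \<xi>)\<^sup>2)"
    "1 + (cmod \<xi>)\<^sup>2 > 0" "1 + (cmod \<xi>)\<^sup>2 \<noteq> 0"
proof -
  show "1 + \<xi> * cnj \<xi> = of_real (1 + (cmod \<xi>)\<^sup>2)" "1 - \<xi> * cnj \<xi> = of_real (1 - (cmod \<xi>)\<^sup>2)"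
    using complex_norm_square[of \<xi>] by simp_all
  show "1 + (cmod \<xi>)\<^sup>2 > 0" by (smt (verit) zero_le_power2)
  then show "1 + (cmod \<xi>)\<^sup>2 \<noteq> 0" by simp
qed

lemma line_chart_line_coords:
  assumes R: "rotation_matrix R" and uv: "norm u = 1" "u \<bullet> v = 0"
    and nz: "1 + (u v* R)$3 \<noteq> 0"
  shows "line_chart R (line_coords (u v* R, v v* R)) = (u, v)"
proof -
  define w y where "w = u v* R" and "y = v v* R"
  define a b c where "a = w$1" and "b = w$2" and "c = w$3"
  define d e f where "d = y$1" and "e = y$2" and "f = y$3"
  define k j where "k = 1 + c" and "j = inverse k"
  have k: "j * k = 1" "k \<noteq> 0" using nz by (simp_all add: k_def c_def w_def j_def)
  have "w \<bullet> w = 1" "w \<bullet> y = 0"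
    using uv rotation_matrix_inverse(3)[OF R] by (simp_all add: w_def y_def norm_eq_1)
  then have r: "a * a + b * b + c * c = 1" "a * d + b * e + c * f = 0"
    by (simp_all add: inner_vec_def sum_3 a_def b_def c_def d_def e_def f_def)
  define \<xi> \<eta> where "\<xi> = Complex (a * j) (b * j)"
    and "\<eta> = Complex (d * j - a * f * j\<^sup>2) (e * j - b * f * j\<^sup>2)"
  have Re_d: "Re (z / of_real r) = Re z * inverse r" "Im (z / of_real r) = Im z * inverse r" for z r
    unfolding Re_divide_of_real Im_divide_of_real by (simp_all only: divide_inverse)
  have coords: "line_coords (w, y) = (\<xi>, \<eta>)"
    unfolding line_coords_def of_real_power[symmetric] prod.case complex_eq_iff prod.inject
      minus_complex.sel Re_d
    by (simp add: \<xi>_def \<eta>_def complex_eq_iff a_def b_def c_def d_def e_def f_def k_def j_def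
        power_inverse)
  have ab: "a * a + b * b = k * (2 - k)" using r(1) by (simp add: k_def algebra_simps)
  have S: "1 + (cmod \<xi>)\<^sup>2 = 2 * j"
    unfolding \<xi>_def cmod_power2 complex.sel using ab k(1) by algebra
  note s = one_plus_square_cnj(1)[of \<xi>, unfolded S]
  have s': "1 - \<xi> * cnj \<xi> = of_real (2 - 2 * j)"
  proof -
    have "1 - \<xi> * cnj \<xi> = 2 - (1 + \<xi> * cnj \<xi>)" by simp
    then show ?thesis unfolding s by simp
  qed
  have i: "inverse (2 * j) = k / 2" "inverse ((2 * j)\<^sup>2) = k\<^sup>2 / 4"
    using k by (simp_all add: j_def power_inverse field_simps)
  have w: "point3 (2 * \<xi> / (1 + \<xi> * cnj \<xi>)) (Re ((1 - \<xi> * cnj \<xi>) / (1 + \<xi> * cnj \<xi>))) = w"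
    unfolding s s' point3_def vec_eq_iff forall_3 vector_3 Re_d i Re_complex_of_real
      a_def[symmetric] b_def[symmetric] c_def[symmetric]
    using k by (simp add: \<xi>_def) (simp add: j_def k_def field_simps)
  have y: "point3 (2 * (\<eta> - \<xi>\<^sup>2 * cnj \<eta>) / (1 + \<xi> * cnj \<xi>)\<^sup>2)
      (Re (- 2 * (\<xi> * cnj \<eta> + cnj \<xi> * \<eta>) / (1 + \<xi> * cnj \<xi>)\<^sup>2)) = y"
    unfolding s point3_def vec_eq_iff forall_3 vector_3 of_real_power[symmetric] Re_d i
      d_def[symmetric] e_def[symmetric] f_def[symmetric]
  proof (intro conjI)
    have c: "c = k - 1" by (simp add: k_def)
    note r' = r(2)[unfolded c] ab k(1)
    show "Re (2 * (\<eta> - \<xi>\<^sup>2 * cnj \<eta>)) * (k\<^sup>2 / 4) = d"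
      using r' by (simp add: \<xi>_def \<eta>_def power2_eq_square) algebra
    show "Im (2 * (\<eta> - \<xi>\<^sup>2 * cnj \<eta>)) * (k\<^sup>2 / 4) = e"
      using r' by (simp add: \<xi>_def \<eta>_def power2_eq_square) algebra
    show "Re (- 2 * (\<xi> * cnj \<eta> + cnj \<xi> * \<eta>)) * (k\<^sup>2 / 4) = f"
      using r' by (simp add: \<xi>_def \<eta>_def power2_eq_square) algebra
  qed
  show ?thesis
    unfolding w_def[symmetric] y_def[symmetric] coords line_chart_def
    using w y rotation_matrix_inverse(1)[OF R] by (simp add: w_def y_def)
qed

lemma line_chart_nonantipodal:
  assumes "rotation_matrix R" "(u, v) = line_chart R z"
  shows "1 + (u v* R)$3 \<noteq> 0"
proof -
  obtain \<xi> \<eta> where z: "z = (\<xi>, \<eta>)" by fastforce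
  let ?s = "(cmod \<xi>)\<^sup>2"
  have "(u v* R)$3 = Re ((1 - \<xi> * cnj \<xi>) / (1 + \<xi> * cnj \<xi>))"
    using assms(2) rotation_matrix_inverse(2)[OF assms(1)]
    by (simp add: z line_chart_def point3_def)
  also have "\<dots> = (1 - ?s) / (1 + ?s)"
    unfolding one_plus_square_cnj of_real_divide[symmetric] by (rule Re_complex_of_real)
  also have "1 + \<dots> = 2 / (1 + ?s)"
    using one_plus_square_cnj(4)[of \<xi>] by (simp add: field_simps)
  finally show ?thesis using one_plus_square_cnj(4)[of \<xi>] by simp
qed

lemma differentiable_cnj [derivative_intros]:
  "f differentiable F \<Longrightarrow> (\<lambda>x. cnj (f x)) differentiable F"
  unfolding differentiable_def by (blast intro: bounded_linear.has_derivative[OF bounded_linear_cnj])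

lemma differentiable_Re_Im:
  "f differentiable F \<Longrightarrow> (\<lambda>x. Re (f x)) differentiable F"
  "f differentiable F \<Longrightarrow> (\<lambda>x. Im (f x)) differentiable F"
  unfolding differentiable_def by (blast intro: has_derivative_Re has_derivative_Im)+

lemma line_chart_differentiable: "line_chart R differentiable (at z)"
proof -
  have point3_alt: "point3 z t = Re z *\<^sub>R axis 1 1 + Im z *\<^sub>R axis 2 1 + t *\<^sub>R axis 3 1" for z t
    by (simp add: point3_def vec_eq_iff forall_3 axis_def)
  have nz: "1 + \<xi> * cnj \<xi> \<noteq> 0" for \<xi>
    unfolding one_plus_square_cnj of_real_eq_0_iff by (rule one_plus_square_cnj)
  have ids: "(\<lambda>x. fst x) differentiable (at z)" "(\<lambda>x. snd x) differentiable (at z)"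
    by (auto intro!: bounded_linear_imp_differentiable bounded_linear_fst bounded_linear_snd)
  note d = differentiable_add differentiable_diff differentiable_mult differentiable_divide
    differentiable_power differentiable_const differentiable_cnj differentiable_Re_Im ids
    differentiable_minus differentiable_scaleR
  have p: "(\<lambda>z. point3 (2 * fst z / (1 + fst z * cnj (fst z)))
        (Re ((1 - fst z * cnj (fst z)) / (1 + fst z * cnj (fst z))))) differentiable (at z)"
    "(\<lambda>z. point3 (2 * (snd z - (fst z)\<^sup>2 * cnj (snd z)) / (1 + fst z * cnj (fst z))\<^sup>2)
        (Re (- 2 * (fst z * cnj (snd z) + cnj (fst z) * snd z) / (1 + fst z * cnj (fst z))\<^sup>2)))
        differentiable (at z)"
    unfolding point3_alt by (intro d; simp add: nz)+
  have "(\<lambda>x. R *v f x) differentiable (at z)" if "f differentiable (at z)" for f :: "complex \<times> complex \<Rightarrow> real^3"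
    using that unfolding differentiable_def
    by (blast intro: bounded_linear.has_derivative[OF matrix_vector_mul_bounded_linear])
  note q = p[THEN this]
  show ?thesis
    using q[unfolded differentiable_def] unfolding line_chart_def case_prod_beta
    by (auto simp: differentiable_def intro: has_derivative_Pair)
qed

lemma line_coords_differentiable:
  assumes "1 + (fst l)$3 \<noteq> 0"
  shows "line_coords differentiable (at l)"
proof -
  have comp: "(\<lambda>x. fst x $ i) differentiable (at l)" "(\<lambda>x. snd x $ i) differentiable (at l)" for i
    by (auto intro!: bounded_linear_imp_differentiable
        bounded_linear_compose[OF bounded_linear_vec_nth] bounded_linear_fst bounded_linear_snd)
  have cr: "(\<lambda>x. complex_of_real (f x)) differentiable (at l)" if "f differentiable (at l)" for f
    using that unfolding differentiable_def by (blast intro: has_derivative_of_real)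
  note d = differentiable_add differentiable_diff differentiable_mult differentiable_divide
    differentiable_power differentiable_const comp cr
  have "complex_of_real (1 + (fst l)$3) \<noteq> 0" using assms by (simp only: of_real_eq_0_iff) simp
  then have "(\<lambda>x. Complex (fst x$1) (fst x$2) / of_real (1 + fst x$3)) differentiable (at l)"
    "(\<lambda>x. Complex (snd x$1) (snd x$2) / of_real (1 + fst x$3)
      - Complex (fst x$1) (fst x$2) * of_real (snd x$3) / (of_real (1 + fst x$3))\<^sup>2) differentiable (at l)"
    unfolding Complex_eq by (intro d; simp)+
  then show ?thesis
    unfolding line_coords_def case_prod_beta by (auto simp: differentiable_def intro: has_derivative_Pair)
qed

lemma eventually_line_chart_line_coords:
  assumes R: "rotation_matrix R" and c: "isCont c t" "\<forall>\<^sub>F s in nhds t. c s \<in> oriented_lines"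
    and nz: "1 + (fst (c t) v* R)$3 \<noteq> 0"
  shows "\<forall>\<^sub>F s in nhds t. c s = line_chart R (line_coords (fst (c s) v* R, snd (c s) v* R))"
proof -
  have "isCont (\<lambda>s. 1 + (fst (c s) v* R)$3) t"
    using c(1) by (auto intro!: continuous_intros
        bounded_linear.isCont[OF matrix_vector_mul_bounded_linear] simp flip: transpose_matrix_vector)
  then have "((\<lambda>s. 1 + (fst (c s) v* R)$3) \<longlongrightarrow> 1 + (fst (c t) v* R)$3) (nhds t)"
    by (simp add: continuous_at tendsto_nhds_iff)
  then have "\<forall>\<^sub>F s in nhds t. 1 + (fst (c s) v* R)$3 \<noteq> 0"
    using nz by (rule tendsto_imp_eventually_ne)
  with c(2) show ?thesis
  proof eventually_elim
    case (elim s)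
    then show ?case using line_chart_line_coords[OF R, of "fst (c s)" "snd (c s)"]
      by (auto simp: oriented_lines_def)
  qed
qed

lemma exists_rotation_nonantipodal:
  fixes u :: "real^3"
  shows "\<exists>R. rotation_matrix R \<and> 1 + (u v* R)$3 \<noteq> 0"
proof (cases "u$3 = -1")
  case False
  then have "rotation_matrix (mat 1 :: real^3^3) \<and> 1 + (u v* mat 1)$3 \<noteq> 0"
    by (simp add: rotation_matrix_def orthogonal_matrix_id)
  then show ?thesis by blast
next
  case True
  \<comment> \<open>the half turn about the first axis\<close>
  define R :: "real^3^3" where "R = vector [vector [1, 0, 0], vector [0, -1, 0], vector [0, 0, -1]]"
  have "transpose R = R"
    by (simp add: R_def transpose_def vec_eq_iff forall_3)
  moreover have "R ** R = mat 1"
    by (simp add: R_def matrix_matrix_mult_def mat_def vec_eq_iff forall_3 sum_3)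
  moreover have "det R = 1" by (simp add: R_def det_3)
  ultimately have "rotation_matrix R" by (simp add: rotation_matrix_def orthogonal_matrix_def)
  moreover have "1 + (u v* R)$3 \<noteq> 0"
    using True by (simp add: R_def vector_matrix_mult_def sum_3)
  ultimately show ?thesis by blast
qed

text \<open>Along a curve of lines, \<open>line_chart R\<close> reproduces the curve from its coordinates, and
  hence the velocity of the curve from the velocity of the coordinates.  So every tangent vector has
  chart components, which is what gives the metric its value there.\<close>

lemma tangent_space_oriented_lines_chart:
  assumes R: "rotation_matrix R" and l: "(u, v) \<in> oriented_lines" "1 + (u v* R)$3 \<noteq> 0"
    and X: "X \<in> tangent_space oriented_lines (u, v)"
  shows "\<exists>a. X = frechet_derivative (line_chart R) (at (line_coords (u v* R, v v* R))) a"
proof -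
  obtain c where c: "c 0 = (u, v)" "\<forall>\<^sub>F t in nhds 0. c t \<in> oriented_lines"
    "(c has_vector_derivative X) (at 0)"
    using X unfolding tangent_space_def by blast
  define g where "g t = line_coords (fst (c t) v* R, snd (c t) v* R)" for t
  have "((\<lambda>t. (fst (c t) v* R, snd (c t) v* R)) has_vector_derivative (fst X v* R, snd X v* R)) (at 0)"
    unfolding transpose_matrix_vector[symmetric]
    by (intro has_vector_derivative_Pair bounded_linear.has_vector_derivative[OF matrix_vector_mul_bounded_linear]
        bounded_linear.has_vector_derivative[OF bounded_linear_fst]
        bounded_linear.has_vector_derivative[OF bounded_linear_snd] c)
  moreover have "(line_coords has_derivative frechet_derivative line_coords (at (u v* R, v v* R)))
      (at (fst (c 0) v* R, snd (c 0) v* R))"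
    using line_coords_differentiable[of "(u v* R, v v* R)"] l c(1)
    by (simp add: frechet_derivative_works)
  ultimately have "\<exists>a. (g has_vector_derivative a) (at 0)"
    using vector_derivative_diff_chain_within[of "\<lambda>t. (fst (c t) v* R, snd (c t) v* R)" _ 0 UNIV line_coords]
    unfolding g_def o_def by (blast intro: has_derivative_at_withinI)
  then obtain a where a: "(g has_vector_derivative a) (at 0)" ..
  have "((\<lambda>t. line_chart R (g t)) has_vector_derivative frechet_derivative (line_chart R) (at (g 0)) a) (at 0)"
    using vector_derivative_diff_chain_within[OF a, of "line_chart R"]
      line_chart_differentiable[of R "g 0"]
    by (simp add: frechet_derivative_works o_def has_derivative_at_withinI)
  moreover have ev: "\<forall>\<^sub>F t in nhds 0. line_chart R (g t) = c t"
    unfolding g_def using eventually_line_chart_line_coords[OF R _ c(2)] c(1) l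
      has_vector_derivative_continuous[OF c(3)] by (auto elim: eventually_mono)
  moreover have "((\<lambda>t. line_chart R (g t)) has_vector_derivative d) (at 0) \<longleftrightarrow>
      (c has_vector_derivative d) (at 0)" for d
    by (rule has_vector_derivative_cong_ev) (use ev eventually_nhds_x_imp_x[OF ev] in auto)
  ultimately have "(c has_vector_derivative frechet_derivative (line_chart R) (at (g 0)) a) (at 0)"
    by simp
  then have "X = frechet_derivative (line_chart R) (at (g 0)) a"
    using c(3) vector_derivative_unique_at by blast
  then have "X = frechet_derivative (line_chart R) (at (line_coords (u v* R, v v* R))) a"
    by (simp add: g_def c(1))
  then show ?thesis by blast
qed

lemma neutral_metric_triple_product:
  assumes l: "(u, v) \<in> oriented_lines"
    and X: "(u1, v1) \<in> tangent_space oriented_lines (u, v)"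
    and Y: "(u2, v2) \<in> tangent_space oriented_lines (u, v)"
  shows "neutral_metric (u, v) (u1, v1) (u2, v2) = - (u \<bullet> cross3 u1 v2 + u \<bullet> cross3 u2 v1) / 4"
proof -
  obtain R where R: "rotation_matrix R" "1 + (u v* R)$3 \<noteq> 0"
    using exists_rotation_nonantipodal by blast
  define z where "z = line_coords (u v* R, v v* R)"
  have z: "line_chart R z = (u, v)"
    using line_chart_line_coords[OF R(1) _ _ R(2)] l by (simp add: z_def oriented_lines_def)
  obtain a b where ab: "(u1, v1) = frechet_derivative (line_chart R) (at z) a"
    "(u2, v2) = frechet_derivative (line_chart R) (at z) b"
    using tangent_space_oriented_lines_chart[OF R(1) l R(2)] X Y unfolding z_def by blast
  have "neutral_metric (u, v) (u1, v1) (u2, v2) = chart_metric z a b"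
    using pullback_neutral_metric[OF R(1)] unfolding pullback_metric_def fun_eq_iff z[symmetric] ab by metis
  then show ?thesis
    unfolding chart_metric_eq[OF R(1)] z ab[symmetric] by simp
qed


section \<open>Christoffel symbols of the neutral metric\<close>

text \<open>Since \<open>\<alpha>\<zeta>\<^sup>* + \<zeta>\<alpha>\<^sup>*\<close> is real, the base point enters only through the real functions
  \<open>\<bar>\<xi>\<bar>\<^sup>2\<close> and \<open>Im (\<xi>\<^sup>* \<eta>)\<close>.\<close>

lemma chart_metric_eq_real:
  "chart_metric (\<xi>, \<eta>) (\<alpha>, \<beta>) (\<zeta>, \<omega>) =
     Im (cnj \<beta> * \<zeta> + cnj \<omega> * \<alpha>) / (1 + (cmod \<xi>)\<^sup>2)\<^sup>2
     + 4 * Re (\<alpha> * cnj \<zeta>) * Im (cnj \<xi> * \<eta>) / (1 + (cmod \<xi>)\<^sup>2) ^ 3"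
proof -
  define S where "S = 1 + (cmod \<xi>)\<^sup>2"
  have S: "S \<noteq> 0" unfolding S_def by (rule one_plus_square_cnj)
  have J: "\<alpha> * cnj \<zeta> + \<zeta> * cnj \<alpha> = of_real (2 * Re (\<alpha> * cnj \<zeta>))"
    by (simp add: complex_eq_iff)
  have K: "2 * cnj \<xi> * \<eta> / of_real S * of_real r = of_real (2 * r / S) * (cnj \<xi> * \<eta>)" for r
    by simp
  have Im_of_real: "Im (of_real r * z) = r * Im z" for r z by simp
  have "(i + 2 * (2 * j) / S * p) / S\<^sup>2 = i / S\<^sup>2 + 4 * j * p / S ^ 3" for i j p
    using S by (simp add: field_simps power2_eq_square power3_eq_cube)
  then show ?thesis
    unfolding chart_metric_def prod.case one_plus_square_cnj S_def[symmetric] J of_real_power[symmetric]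
      Im_divide_of_real K plus_complex.sel Im_of_real .
qed

lemma frechet_derivative_chart_metric:
  fixes \<xi> \<eta> :: complex
  defines "m \<equiv> inverse (1 + (cmod \<xi>)\<^sup>2)"
  shows "frechet_derivative (\<lambda>x. chart_metric x (\<alpha>, \<beta>) (\<zeta>, \<omega>)) (at (\<xi>, \<eta>)) (\<mu>, \<nu>) =
    - 4 * Re (cnj \<xi> * \<mu>) * Im (cnj \<beta> * \<zeta> + cnj \<omega> * \<alpha>) * m ^ 3
    + 4 * Re (\<alpha> * cnj \<zeta>) * Im (cnj \<mu> * \<eta> + cnj \<xi> * \<nu>) * m ^ 3
    - 24 * Re (\<alpha> * cnj \<zeta>) * Im (cnj \<xi> * \<eta>) * Re (cnj \<xi> * \<mu>) * m ^ 4"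
proof -
  define I J where "I = Im (cnj \<beta> * \<zeta> + cnj \<omega> * \<alpha>)" and "J = 4 * Re (\<alpha> * cnj \<zeta>)"
  define S where "S z = 1 + ((Re z)\<^sup>2 + (Im z)\<^sup>2)" for z
  have S: "S z \<noteq> 0" for z unfolding S_def by (smt (verit) zero_le_power2)
  have dS: "(S has_derivative (\<lambda>\<mu>. 2 * Re (cnj z * \<mu>))) (at z)" for z
    unfolding S_def by (auto intro!: derivative_eq_intros simp: algebra_simps)
  have di: "((\<lambda>x. inverse (S (fst x))) has_derivative
      (\<lambda>v. - (2 * Re (cnj (fst x) * fst v)) * (inverse (S (fst x)))\<^sup>2)) (at x)" for x :: "complex \<times> complex"
    by (auto intro!: derivative_eq_intros S has_derivative_compose[OF has_derivative_fst[OF has_derivative_ident] dS]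
        simp: power2_eq_square fun_eq_iff algebra_simps)
  have dk: "((\<lambda>x. Im (cnj (fst x) * snd x)) has_derivative
      (\<lambda>v. Im (cnj (fst v) * snd x + cnj (fst x) * snd v))) (at x)" for x :: "complex \<times> complex"
    by (auto intro!: derivative_eq_intros)
  have g: "chart_metric x (\<alpha>, \<beta>) (\<zeta>, \<omega>) = I * (inverse (S (fst x)))\<^sup>2
      + J * (Im (cnj (fst x) * snd x) * inverse (S (fst x)) ^ 3)" for x
    by (cases x) (simp only: chart_metric_eq_real cmod_power2 I_def J_def S_def fst_conv snd_conv
        divide_inverse power_inverse mult.assoc)
  have "((\<lambda>x. chart_metric x (\<alpha>, \<beta>) (\<zeta>, \<omega>)) has_derivative
      (\<lambda>v. I * (2 * (- (2 * Re (cnj (fst x) * fst v)) * (inverse (S (fst x)))\<^sup>2) * inverse (S (fst x)))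
        + J * (Im (cnj (fst v) * snd x + cnj (fst x) * snd v) * inverse (S (fst x)) ^ 3
          + Im (cnj (fst x) * snd x) * (3 * (- (2 * Re (cnj (fst x) * fst v)) * (inverse (S (fst x)))\<^sup>2)
             * (inverse (S (fst x)))\<^sup>2)))) (at x)" for x
    unfolding g by (rule derivative_eq_intros di dk refl | simp add: algebra_simps)+
  from frechet_derivative_at[OF this, symmetric]
  have "frechet_derivative (\<lambda>x. chart_metric x (\<alpha>, \<beta>) (\<zeta>, \<omega>)) (at (\<xi>, \<eta>)) (\<mu>, \<nu>) =
      I * (2 * (- (2 * Re (cnj \<xi> * \<mu>)) * m\<^sup>2) * m)
        + J * (Im (cnj \<mu> * \<eta> + cnj \<xi> * \<nu>) * m ^ 3
          + Im (cnj \<xi> * \<eta>) * (3 * (- (2 * Re (cnj \<xi> * \<mu>)) * m\<^sup>2) * m\<^sup>2))"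
    by (simp add: m_def S_def cmod_power2)
  then show ?thesis unfolding I_def[symmetric] unfolding J_def by algebra
qed

text \<open>The metric pairs \<open>d\<xi>\<close> with \<open>d\<eta>\<close>, so vectors \<open>(0, z\<^sub>2)\<close> detect the first component and then
  vectors \<open>(z\<^sub>1, 0)\<close> detect the second one.  This makes the Christoffel symbols unique.\<close>

lemma chart_metric_nondegenerate:
  assumes "\<And>z. chart_metric x y z = chart_metric x y' z"
  shows "y = y'"
proof -
  obtain \<xi> \<eta> y1 y2 y1' y2' where [simp]: "x = (\<xi>, \<eta>)" "y = (y1, y2)" "y' = (y1', y2')"
    by (metis surj_pair)
  have S: "1 + (cmod \<xi>)\<^sup>2 \<noteq> 0" by (rule one_plus_square_cnj)
  have "Im (cnj z2 * y1) = Im (cnj z2 * y1')" for z2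
    using assms[of "(0, z2)"] S by (simp add: chart_metric_eq_real)
  from this[of 1] this[of "\<i>"] have 1: "y1 = y1'" by (simp add: complex_eq_iff)
  have "Im (cnj y2 * z1) = Im (cnj y2' * z1)" for z1
    using assms[of "(z1, 0)"] S by (simp add: chart_metric_eq_real 1)
  from this[of 1] this[of "\<i>"] 1 show ?thesis by (simp add: complex_eq_iff)
qed

text \<open>The Koszul formula for the vector \<open>(Y, \<dots>)\<close> with the denominators cleared: the terms with the factor
  \<open>S\<close> are the coefficients of \<open>1 / S\<^sup>3\<close>, the others those of \<open>1 / S\<^sup>4\<close>.\<close>

lemma christoffel_polynomial_identity:
  fixes \<xi> \<eta> \<alpha> \<beta> \<zeta> \<omega> :: complex
  defines "S \<equiv> 1 + (cmod \<xi>)\<^sup>2"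
  defines "Y \<equiv> - 2 * cnj \<xi> * \<alpha>\<^sup>2"
  shows "S * Im (cnj (- 4 * cnj \<xi> * \<alpha> * \<beta>) * \<zeta> + cnj \<omega> * Y)
      + Im (cnj (2 * \<alpha>\<^sup>2 * (cnj \<eta> + (cnj \<xi>)\<^sup>2 * \<eta>)) * \<zeta>) + 4 * Re (Y * cnj \<zeta>) * Im (cnj \<xi> * \<eta>)
    = S * (- 4 * Re (cnj \<xi> * \<alpha>) * Im (cnj \<beta> * \<zeta> + cnj \<omega> * \<alpha>)
        + 4 * Re (\<alpha> * cnj \<zeta>) * Im (cnj \<alpha> * \<eta> + cnj \<xi> * \<beta>)
        + 4 * Re (cnj \<xi> * \<zeta>) * Im (cnj \<beta> * \<alpha>)
        - 2 * Re (\<alpha> * cnj \<alpha>) * Im (cnj \<zeta> * \<eta> + cnj \<xi> * \<omega>))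
      - 24 * Re (\<alpha> * cnj \<zeta>) * Im (cnj \<xi> * \<eta>) * Re (cnj \<xi> * \<alpha>)
      + 12 * Re (\<alpha> * cnj \<alpha>) * Im (cnj \<xi> * \<eta>) * Re (cnj \<xi> * \<zeta>)"
proof -
  obtain x1 x2 e1 e2 a1 a2 b1 b2 z1 z2 o1 o2 where [simp]: "\<xi> = Complex x1 x2" "\<eta> = Complex e1 e2"
    "\<alpha> = Complex a1 a2" "\<beta> = Complex b1 b2" "\<zeta> = Complex z1 z2" "\<omega> = Complex o1 o2"
    by (metis complex.exhaust)
  show ?thesis
    unfolding S_def Y_def cmod_power2 by (simp add: power2_eq_square) algebra
qed

text \<open>In the Koszul formula, the terms with \<open>\<omega>\<close> determine the first component.  It contains neither
  \<open>\<eta>\<close> nor \<open>\<beta>\<close> and is the one of the round sphere, so the directions of the lines of a geodesic run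
  through a great circle.  The terms with \<open>\<zeta>\<close> then determine the second component.\<close>

lemma christoffel_chart_metric:
  fixes \<xi> \<eta> \<alpha> \<beta> :: complex
  defines "m \<equiv> inverse (1 + (cmod \<xi>)\<^sup>2)"
  shows "christoffel chart_metric (\<xi>, \<eta>) (\<alpha>, \<beta>) (\<alpha>, \<beta>) =
    (of_real m * (- 2 * cnj \<xi> * \<alpha>\<^sup>2),
     of_real m * (- 4 * cnj \<xi> * \<alpha> * \<beta>) + of_real (m\<^sup>2) * (2 * \<alpha>\<^sup>2 * (cnj \<eta> + (cnj \<xi>)\<^sup>2 * \<eta>)))"
    (is "_ = ?Y")
proof -
  let ?D = "\<lambda>y z v. frechet_derivative (\<lambda>x. chart_metric x y z) (at (\<xi>, \<eta>)) v"
  have koszul: "chart_metric (\<xi>, \<eta>) ?Y z =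
    (?D (\<alpha>, \<beta>) z (\<alpha>, \<beta>) + ?D (\<alpha>, \<beta>) z (\<alpha>, \<beta>) - ?D (\<alpha>, \<beta>) (\<alpha>, \<beta>) z) / 2" for z
  proof -
    obtain \<zeta> \<omega> where z: "z = (\<zeta>, \<omega>)" by fastforce
    define S where "S = 1 + (cmod \<xi>)\<^sup>2"
    have mS: "m * S = 1" using one_plus_square_cnj(4)[of \<xi>] by (simp add: m_def S_def)
    define A where "A = Im (cnj (- 4 * cnj \<xi> * \<alpha> * \<beta>) * \<zeta> + cnj \<omega> * (- 2 * cnj \<xi> * \<alpha>\<^sup>2))"
    define B where "B = Im (cnj (2 * \<alpha>\<^sup>2 * (cnj \<eta> + (cnj \<xi>)\<^sup>2 * \<eta>)) * \<zeta>)
      + 4 * Re (- 2 * cnj \<xi> * \<alpha>\<^sup>2 * cnj \<zeta>) * Im (cnj \<xi> * \<eta>)"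
    define C where "C = - 4 * Re (cnj \<xi> * \<alpha>) * Im (cnj \<beta> * \<zeta> + cnj \<omega> * \<alpha>)
        + 4 * Re (\<alpha> * cnj \<zeta>) * Im (cnj \<alpha> * \<eta> + cnj \<xi> * \<beta>)
        + 4 * Re (cnj \<xi> * \<zeta>) * Im (cnj \<beta> * \<alpha>)
        - 2 * Re (\<alpha> * cnj \<alpha>) * Im (cnj \<zeta> * \<eta> + cnj \<xi> * \<omega>)"
    define D where "D = - 24 * Re (\<alpha> * cnj \<zeta>) * Im (cnj \<xi> * \<eta>) * Re (cnj \<xi> * \<alpha>)
      + 12 * Re (\<alpha> * cnj \<alpha>) * Im (cnj \<xi> * \<eta>) * Re (cnj \<xi> * \<zeta>)"
    have "S * A + B = S * C + D"
      using christoffel_polynomial_identity[of \<xi> \<alpha> \<beta> \<zeta> \<omega> \<eta>] unfolding A_def B_def C_def D_def S_def by linarith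
    then have "m ^ 3 * A + m ^ 4 * B = m ^ 3 * C + m ^ 4 * D" using mS by algebra
    moreover have "chart_metric (\<xi>, \<eta>) ?Y z = m ^ 3 * A + m ^ 4 * B"
    proof -
      have lin: "Im (cnj (of_real m * Q + of_real n * T) * \<zeta> + cnj \<omega> * (of_real m * P))
          = m * Im (cnj Q * \<zeta> + cnj \<omega> * P) + n * Im (cnj T * \<zeta>)"
        "Re (of_real m * P * cnj \<zeta>) = m * Re (P * cnj \<zeta>)" for P Q T n
        by (simp_all add: algebra_simps)
      have "(m * a + m\<^sup>2 * b) * m\<^sup>2 + 4 * (m * c) * k * m ^ 3 = m ^ 3 * a + m ^ 4 * (b + 4 * c * k)" for a b c k
        by algebra
      then show ?thesis
        unfolding z chart_metric_eq_real divide_inverse power_inverse[symmetric] m_def[symmetric] A_def B_def lin .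
    qed
    moreover have "(?D (\<alpha>, \<beta>) z (\<alpha>, \<beta>) + ?D (\<alpha>, \<beta>) z (\<alpha>, \<beta>) - ?D (\<alpha>, \<beta>) (\<alpha>, \<beta>) z) / 2
        = m ^ 3 * C + m ^ 4 * D"
    proof -
      have two: "Im (cnj \<beta> * \<alpha> + cnj \<beta> * \<alpha>) = 2 * Im (cnj \<beta> * \<alpha>)" by simp
      have "(- 4 * r * i * m ^ 3 + 4 * a * k * m ^ 3 - 24 * a * q * r * m ^ 4
          + (- 4 * r * i * m ^ 3 + 4 * a * k * m ^ 3 - 24 * a * q * r * m ^ 4)
          - (- 4 * r' * (2 * b) * m ^ 3 + 4 * c * k' * m ^ 3 - 24 * c * q * r' * m ^ 4)) / 2
          = m ^ 3 * (- 4 * r * i + 4 * a * k + 4 * r' * b - 2 * c * k') + m ^ 4 * (- 24 * a * q * r + 12 * c * q * r')"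
        for r i a k q r' b c k' by (simp add: field_simps)
      then show ?thesis
        unfolding z frechet_derivative_chart_metric m_def[symmetric] C_def D_def two .
    qed
    ultimately show ?thesis by simp
  qed
  show ?thesis
    unfolding christoffel_def
  proof (rule the_equality)
    show "\<forall>z. chart_metric (\<xi>, \<eta>) ?Y z =
      (?D (\<alpha>, \<beta>) z (\<alpha>, \<beta>) + ?D (\<alpha>, \<beta>) z (\<alpha>, \<beta>) - ?D (\<alpha>, \<beta>) (\<alpha>, \<beta>) z) / 2"
      using koszul by blast
    fix y
    assume y: "\<forall>z. chart_metric (\<xi>, \<eta>) y z =
      (?D (\<alpha>, \<beta>) z (\<alpha>, \<beta>) + ?D (\<alpha>, \<beta>) z (\<alpha>, \<beta>) - ?D (\<alpha>, \<beta>) (\<alpha>, \<beta>) z) / 2"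
    show "y = ?Y"
      by (rule chart_metric_nondegenerate[of "(\<xi>, \<eta>)"]) (simp only: y koszul)
  qed
qed


section \<open>Pencils of lines are geodesics\<close>

lemma has_vector_derivative_Complex:
  assumes "(f has_real_derivative f') (at t)" "(g has_real_derivative g') (at t)"
  shows "((\<lambda>t. Complex (f t) (g t)) has_vector_derivative Complex f' g') (at t)"
proof -
  have "((\<lambda>t. f t *\<^sub>R 1 + g t *\<^sub>R \<i>) has_vector_derivative f' *\<^sub>R 1 + g' *\<^sub>R \<i>) (at t)"
    using assms by (auto intro!: derivative_eq_intros)
  then show ?thesis by (simp add: Complex_eq scaleR_conv_of_real mult.commute)
qed

text \<open>The \<open>\<eta>\<close>-component of the geodesic equation of a pencil, where \<open>x = \<xi>\<close>, \<open>X = \<xi>\<^sup>*\<close>,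
  \<open>a = \<xi>'\<close>, \<open>A = \<xi>'\<^sup>*\<close> and \<open>h = 1 / (1 + \<xi>\<xi>\<^sup>*)\<close> with derivative \<open>W / 2\<close>, and where \<open>\<eta> = f \<xi>'\<close>
  and \<open>g = f\<^sup>*\<close>.  The derivatives of \<open>f\<close> are \<open>f' = - P\<close> and \<open>f'' = - B\<close>.
  The terms with \<open>P\<close> and those with \<open>X\<^sup>2\<close> cancel, and what remains is \<open>(Re f - B) \<xi>'\<close>.\<close>

lemma pencil_polynomial_identity:
  fixes x X a A f g h W B P :: complex
  assumes "h * (1 + x * X) = 1" "4 * h\<^sup>2 * (a * A) = 1" "W = - 2 * h\<^sup>2 * (X * a + x * A)" "g = 2 * B - f"
  shows "- B * a - 2 * P * (2 * h * X * a\<^sup>2)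
    + f * (W * X * a\<^sup>2 + 2 * h * (A * a\<^sup>2 + 2 * X * a * (2 * h * X * a\<^sup>2)))
    + (h * (- 4 * X * a * (- P * a + f * (2 * h * X * a\<^sup>2)))
      + h\<^sup>2 * (2 * a\<^sup>2 * (g * A + X\<^sup>2 * (f * a)))) = 0"
proof -
  have 1: "2 * h\<^sup>2 * A * a\<^sup>2 = a / 2" using assms(2) by algebra
  have 2: "W * X * a\<^sup>2 + 2 * h * A * a\<^sup>2 = 2 * h\<^sup>2 * A * a\<^sup>2 - 2 * h\<^sup>2 * X\<^sup>2 * a ^ 3"
    using assms(1) unfolding assms(3) by algebra
  have "f * (W * X * a\<^sup>2 + 2 * h * A * a\<^sup>2) = f * (a / 2) - 2 * f * h\<^sup>2 * X\<^sup>2 * a ^ 3"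
    unfolding 2 1 by (simp add: algebra_simps)
  moreover have "g * (2 * h\<^sup>2 * A * a\<^sup>2) = g * (a / 2)" unfolding 1 ..
  moreover have "g * (a / 2) = B * a - f * (a / 2)" unfolding assms(4) by (simp add: algebra_simps)
  ultimately show ?thesis by algebra
qed

text \<open>The directions of the lines of a pencil.  The only singularity of the coordinates is the south pole,
  where \<open>k\<close> vanishes.\<close>

locale great_circle =
  fixes w w' :: "real \<Rightarrow> real^3"
  assumes w: "(w has_vector_derivative w' t) (at t)"
    and w': "(w' has_vector_derivative - w t) (at t)"
    and orthonormal: "w t \<bullet> w t = 1" "w' t \<bullet> w' t = 1" "w t \<bullet> w' t = 0"
begin

definition k where "k t = 1 + w t $ 3"

text \<open>The stereographic coordinate of \<open>w t\<close> and its velocity.\<close>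

definition \<xi> where "\<xi> t = Complex (w t $ 1) (w t $ 2) / of_real (k t)"

definition \<xi>' where
  "\<xi>' t = Complex (w' t $ 1) (w' t $ 2) / of_real (k t)
     - Complex (w t $ 1) (w t $ 2) * of_real (w' t $ 3) / (of_real (k t))\<^sup>2"

lemma components:
  "((\<lambda>t. w t $ i) has_vector_derivative w' t $ i) (at t)"
  "((\<lambda>t. w' t $ i) has_vector_derivative - w t $ i) (at t)"
  "(k has_vector_derivative w' t $ 3) (at t)"
  using bounded_linear.has_vector_derivative[OF bounded_linear_vec_nth w, of i]
    bounded_linear.has_vector_derivative[OF bounded_linear_vec_nth w', of i]
    bounded_linear.has_vector_derivative[OF bounded_linear_vec_nth w, of 3]
  unfolding k_def by (auto intro!: derivative_eq_intros)

lemma real_components: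
  "((\<lambda>t. w t $ i) has_real_derivative w' t $ i) (at t)"
  "((\<lambda>t. w' t $ i) has_real_derivative - w t $ i) (at t)"
  using components by (simp_all add: has_real_derivative_iff_has_vector_derivative)

lemma inverse_k:
  "k t \<noteq> 0 \<Longrightarrow> ((\<lambda>t. inverse (k t)) has_real_derivative - w' t $ 3 * (inverse (k t))\<^sup>2) (at t)"
  using components(3)[of t] unfolding has_real_derivative_iff_has_vector_derivative[symmetric]
  by (auto intro!: derivative_eq_intros simp: power2_eq_square)

lemma orthonormal_components:
  "w t $ 1 * w t $ 1 + w t $ 2 * w t $ 2 + w t $ 3 * w t $ 3 = 1"
  "w' t $ 1 * w' t $ 1 + w' t $ 2 * w' t $ 2 + w' t $ 3 * w' t $ 3 = 1"
  "w t $ 1 * w' t $ 1 + w t $ 2 * w' t $ 2 + w t $ 3 * w' t $ 3 = 0"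
  using orthonormal[of t] by (simp_all add: inner_vec_def sum_3)

lemma continuous_k: "continuous_on UNIV k"
  using components(3) has_vector_derivative_continuous
  by (blast intro: continuous_at_imp_continuous_on)

lemma open_k: "open {t. k t \<noteq> 0}"
  using open_Collect_neq[OF continuous_k continuous_on_const] .

lemma \<xi>_square: "k t \<noteq> 0 \<Longrightarrow> 1 + (cmod (\<xi> t))\<^sup>2 = 2 / k t"
proof -
  assume k: "k t \<noteq> 0"
  have "w t $ 1 * w t $ 1 + w t $ 2 * w t $ 2 = k t * (2 - k t)"
    using orthonormal_components(1)[of t] by (simp add: k_def algebra_simps)
  then show ?thesis
    using k by (simp add: \<xi>_def norm_divide power_divide cmod_power2)
      (simp add: power2_eq_square field_simps)
qed

lemma \<xi>_real_form:
  "\<xi> t = Complex (w t $ 1 * inverse (k t)) (w t $ 2 * inverse (k t))"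
  "\<xi>' t = Complex (w' t $ 1 * inverse (k t) - w t $ 1 * w' t $ 3 * (inverse (k t))\<^sup>2)
     (w' t $ 2 * inverse (k t) - w t $ 2 * w' t $ 3 * (inverse (k t))\<^sup>2)"
  unfolding \<xi>_def \<xi>'_def complex_eq_iff of_real_power[symmetric] minus_complex.sel
    Re_divide_of_real Im_divide_of_real
  by (simp_all add: divide_inverse power_inverse)

text \<open>Stereographic projection is conformal, with the factor \<open>1 / k = (1 + \<bar>\<xi>\<bar>\<^sup>2) / 2\<close>.\<close>

lemma \<xi>'_square: "k t \<noteq> 0 \<Longrightarrow> \<xi>' t * cnj (\<xi>' t) * of_real ((k t)\<^sup>2) = 1"
proof -
  assume "k t \<noteq> 0"
  define j where "j = inverse (k t)"
  have j: "j * k t = 1" using \<open>k t \<noteq> 0\<close> by (simp add: j_def)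
  have w3: "w t $ 3 = k t - 1" by (simp add: k_def)
  have "((w' t $ 1 * j - w t $ 1 * w' t $ 3 * j\<^sup>2)\<^sup>2 + (w' t $ 2 * j - w t $ 2 * w' t $ 3 * j\<^sup>2)\<^sup>2) * (k t)\<^sup>2 = 1"
    using orthonormal_components[of t] j unfolding w3 by algebra
  then have "(cmod (\<xi>' t))\<^sup>2 * (k t)\<^sup>2 = 1"
    by (simp add: \<xi>_real_form cmod_power2 j_def)
  then show ?thesis
    unfolding complex_norm_square[symmetric] by (simp flip: of_real_mult of_real_power)
qed

lemma k_derivative: "k t \<noteq> 0 \<Longrightarrow> w' t $ 3 = - (k t)\<^sup>2 * Re (cnj (\<xi> t) * \<xi>' t)"
proof -
  assume "k t \<noteq> 0"
  define j where "j = inverse (k t)"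
  have j: "j * k t = 1" using \<open>k t \<noteq> 0\<close> by (simp add: j_def)
  have w3: "w t $ 3 = k t - 1" by (simp add: k_def)
  show ?thesis
    unfolding \<xi>_real_form j_def[symmetric]
    using orthonormal_components[of t] j unfolding w3 by simp algebra
qed

lemma \<xi>_derivative: "k t \<noteq> 0 \<Longrightarrow> (\<xi> has_vector_derivative \<xi>' t) (at t)"
proof -
  assume k: "k t \<noteq> 0"
  note d = real_components inverse_k[OF k]
  show ?thesis
    unfolding \<xi>_real_form
    by (rule has_vector_derivative_Complex; (rule derivative_eq_intros d refl)+)
      (simp_all add: algebra_simps power2_eq_square)
qed

text \<open>The equation of great circles, since \<open>k = 2 / (1 + \<bar>\<xi>\<bar>\<^sup>2)\<close>.\<close>

lemma \<xi>'_derivative: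
  "k t \<noteq> 0 \<Longrightarrow> (\<xi>' has_vector_derivative of_real (k t) * cnj (\<xi> t) * (\<xi>' t)\<^sup>2) (at t)"
proof -
  assume k: "k t \<noteq> 0"
  define j where "j = inverse (k t)"
  have j: "j * k t = 1" using k by (simp add: j_def)
  have w3: "w t $ 3 = k t - 1" by (simp add: k_def)
  note d = real_components inverse_k[OF k]
  let ?d = "\<lambda>i. - w t $ i * j - w' t $ i * w' t $ 3 * j\<^sup>2
    - (w' t $ i * w' t $ 3 * j\<^sup>2 - w t $ i * w t $ 3 * j\<^sup>2 - 2 * w t $ i * (w' t $ 3)\<^sup>2 * j ^ 3)"
  have D: "((\<lambda>t. w' t $ i * inverse (k t) - w t $ i * w' t $ 3 * (inverse (k t))\<^sup>2)
      has_real_derivative ?d i) (at t)" for i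
    by (rule derivative_eq_intros d refl)+
      (simp add: j_def[symmetric] algebra_simps power2_eq_square power3_eq_cube)
  have "Complex (?d 1) (?d 2) = of_real (k t) * cnj (\<xi> t) * (\<xi>' t)\<^sup>2"
    unfolding complex_eq_iff \<xi>_real_form j_def[symmetric] complex.sel
  proof (intro conjI, goal_cases)
    case 1
    then show ?case
      using orthonormal_components[of t] j unfolding w3 by (simp add: power2_eq_square) algebra
  next
    case 2
    then show ?case
      using orthonormal_components[of t] j unfolding w3 by (simp add: power2_eq_square) algebra
  qed
  then show ?thesis
    using has_vector_derivative_Complex[OF D D, of 1 2] by (simp add: \<xi>_real_form flip: \<xi>_real_form(2))
qed

lemma frame_expansion:
  "q - (q \<bullet> w t) *\<^sub>R w t = (q \<bullet> w' t) *\<^sub>R w' t + (q \<bullet> cross3 (w t) (w' t)) *\<^sub>R cross3 (w t) (w' t)"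
  unfolding vec_eq_iff forall_3
proof (intro conjI, goal_cases)
  case 1
  then show ?case using orthonormal_components[of t]
    by (simp add: inner_vec_def sum_3 cross3_def) algebra
next
  case 2
  then show ?case using orthonormal_components[of t]
    by (simp add: inner_vec_def sum_3 cross3_def) algebra
next
  case 3
  then show ?case using orthonormal_components[of t]
    by (simp add: inner_vec_def sum_3 cross3_def) algebra
qed

text \<open>The foot point has components along \<open>w'\<close> and along \<open>w \<times> w'\<close>.  By conformality, the projection
  maps \<open>w \<times> w'\<close> to \<open>\<i> \<xi>'\<close>, so \<open>\<eta>\<close> is a complex multiple of \<open>\<xi>'\<close>.\<close>

lemma line_coords_pencil:
  fixes q :: "real^3"
  assumes "k t \<noteq> 0"
  shows "line_coords (w t, q - (q \<bullet> w t) *\<^sub>R w t)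
    = (\<xi> t, Complex (q \<bullet> w' t) (q \<bullet> cross3 (w t) (w' t)) * \<xi>' t)"
proof -
  let ?n = "cross3 (w t) (w' t)"
  let ?D = "\<lambda>y. Complex (y $ 1) (y $ 2) / of_real (k t)
     - Complex (w t $ 1) (w t $ 2) * of_real (y $ 3) / (of_real (k t))\<^sup>2"
  have lin: "?D (b *\<^sub>R w' t + c *\<^sub>R ?n) = of_real b * ?D (w' t) + of_real c * ?D ?n" for b c
    by (simp add: Complex_eq add_divide_distrib diff_divide_distrib algebra_simps)
  define j where "j = inverse (k t)"
  have j: "j * k t = 1" using \<open>k t \<noteq> 0\<close> by (simp add: j_def)
  have w3: "w t $ 3 = k t - 1" by (simp add: k_def)
  have n: "?D ?n = \<i> * \<xi>' t"
    unfolding \<xi>_real_form of_real_power[symmetric] complex_eq_iff minus_complex.sel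
      Re_divide_of_real Im_divide_of_real
    unfolding divide_inverse power_inverse[symmetric] j_def[symmetric]
    using orthonormal_components[of t] j unfolding w3
    by (simp add: cross3_def w3) algebra
  have "line_coords (w t, q - (q \<bullet> w t) *\<^sub>R w t) = (\<xi> t, ?D (q - (q \<bullet> w t) *\<^sub>R w t))"
    by (simp add: line_coords_def \<xi>_def k_def)
  also have "?D (q - (q \<bullet> w t) *\<^sub>R w t)
      = of_real (q \<bullet> w' t) * \<xi>' t + of_real (q \<bullet> ?n) * (\<i> * \<xi>' t)"
    unfolding frame_expansion lin n by (simp add: \<xi>'_def)
  finally show ?thesis by (simp add: Complex_eq algebra_simps)
qed

text \<open>The ratio \<open>\<eta> / \<xi>'\<close> for the pencil through \<open>q\<close>.  Its imaginary part is the signed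
  distance of \<open>q\<close> from the plane of the great circle, which is constant.\<close>

definition f where "f q t = Complex (q \<bullet> w' t) (q \<bullet> cross3 (w t) (w' t))"

lemma f_derivative: "(f q has_vector_derivative - of_real (q \<bullet> w t)) (at t)"
proof -
  have "((\<lambda>t. q \<bullet> w' t) has_real_derivative - (q \<bullet> w t)) (at t)"
    unfolding has_real_derivative_iff_has_vector_derivative
    using bounded_linear.has_vector_derivative[OF bounded_linear_inner_right w'] by simp
  moreover have "((\<lambda>t. q \<bullet> cross3 (w t) (w' t)) has_real_derivative 0) (at t)"
    unfolding inner_vec_def sum_3 cross3_def vector_3 inner_real_def
    by (rule derivative_eq_intros real_components refl)+ (simp add: algebra_simps)
  ultimately have "((\<lambda>t. Complex (q \<bullet> w' t) (q \<bullet> cross3 (w t) (w' t))) has_vector_derivative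
      Complex (- (q \<bullet> w t)) 0) (at t)"
    by (rule has_vector_derivative_Complex)
  moreover have "Complex (- (q \<bullet> w t)) 0 = - of_real (q \<bullet> w t)" by (simp add: complex_eq_iff)
  ultimately show ?thesis by (simp add: f_def[abs_def])
qed

definition \<xi>\<^sub>2 where "\<xi>\<^sub>2 t = of_real (k t) * cnj (\<xi> t) * (\<xi>' t)\<^sup>2"

definition \<xi>\<^sub>3 where "\<xi>\<^sub>3 t = of_real (w' t $ 3) * cnj (\<xi> t) * (\<xi>' t)\<^sup>2
  + of_real (k t) * (cnj (\<xi>' t) * (\<xi>' t)\<^sup>2 + 2 * cnj (\<xi> t) * \<xi>' t * \<xi>\<^sub>2 t)"

lemma \<xi>\<^sub>2_derivative: "k t \<noteq> 0 \<Longrightarrow> (\<xi>\<^sub>2 has_vector_derivative \<xi>\<^sub>3 t) (at t)"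
proof -
  assume k: "k t \<noteq> 0"
  have c: "((\<lambda>t. cnj (\<xi> t)) has_vector_derivative cnj (\<xi>' t)) (at t)"
    using bounded_linear.has_vector_derivative[OF bounded_linear_cnj \<xi>_derivative[OF k]] .
  have kd: "((\<lambda>t. of_real (k t)) has_vector_derivative complex_of_real (w' t $ 3)) (at t)"
    using bounded_linear.has_vector_derivative[OF bounded_linear_of_real components(3)] .
  note d = \<xi>'_derivative[OF k, folded \<xi>\<^sub>2_def]
  show ?thesis
    unfolding \<xi>\<^sub>2_def[abs_def] power2_eq_square
    using has_vector_derivative_mult[OF has_vector_derivative_mult[OF kd c] has_vector_derivative_mult[OF d d]]
    by (simp add: \<xi>\<^sub>3_def power2_eq_square algebra_simps)
qed

text \<open>The geodesic equation of the pencil through \<open>q\<close>; the vectors are the first and second derivatives of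
  the coordinates \<open>(\<xi>, f q \<xi>')\<close>.\<close>

lemma christoffel_pencil:
  assumes k: "k t \<noteq> 0"
  shows "(\<xi>\<^sub>2 t, - of_real (q \<bullet> w' t) * \<xi>' t - 2 * of_real (q \<bullet> w t) * \<xi>\<^sub>2 t + f q t * \<xi>\<^sub>3 t)
    + christoffel chart_metric (\<xi> t, f q t * \<xi>' t)
      (\<xi>' t, - of_real (q \<bullet> w t) * \<xi>' t + f q t * \<xi>\<^sub>2 t)
      (\<xi>' t, - of_real (q \<bullet> w t) * \<xi>' t + f q t * \<xi>\<^sub>2 t) = 0"
proof -
  have m: "inverse (1 + (cmod (\<xi> t))\<^sup>2) = k t / 2"
    using \<xi>_square[OF k] by simp
  have fB: "2 * of_real (q \<bullet> w' t) = f q t + cnj (f q t)"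
    by (simp add: f_def complex_eq_iff)
  have r1: "of_real (k t) * (1 + \<xi> t * cnj (\<xi> t)) = 2"
    using k unfolding one_plus_square_cnj \<xi>_square[OF k] by (simp flip: of_real_mult)
  have r2: "\<xi>' t * cnj (\<xi>' t) * (of_real (k t))\<^sup>2 = 1"
    using \<xi>'_square[OF k] by simp
  have "2 * complex_of_real (Re (cnj (\<xi> t) * \<xi>' t)) = cnj (\<xi> t) * \<xi>' t + \<xi> t * cnj (\<xi>' t)"
    by (simp add: complex_eq_iff)
  then have r3: "2 * complex_of_real (w' t $ 3)
      = - (of_real (k t))\<^sup>2 * (cnj (\<xi> t) * \<xi>' t + \<xi> t * cnj (\<xi>' t))"
    unfolding k_derivative[OF k] of_real_mult of_real_minus of_real_power by algebra
  show ?thesis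
    unfolding christoffel_chart_metric m plus_prod_def fst_conv snd_conv zero_prod_def prod.inject
      of_real_divide of_real_power of_real_numeral complex_cnj_mult
  proof (intro conjI)
    show "\<xi>\<^sub>2 t + of_real (k t) / 2 * (- 2 * cnj (\<xi> t) * (\<xi>' t)\<^sup>2) = 0"
      by (simp add: \<xi>\<^sub>2_def)
    show "- of_real (q \<bullet> w' t) * \<xi>' t - 2 * of_real (q \<bullet> w t) * \<xi>\<^sub>2 t + f q t * \<xi>\<^sub>3 t +
      (of_real (k t) / 2 * (- 4 * cnj (\<xi> t) * \<xi>' t * (- of_real (q \<bullet> w t) * \<xi>' t + f q t * \<xi>\<^sub>2 t))
        + (of_real (k t) / 2)\<^sup>2 * (2 * (\<xi>' t)\<^sup>2 *
          (cnj (f q t) * cnj (\<xi>' t) + (cnj (\<xi> t))\<^sup>2 * (f q t * \<xi>' t)))) = 0"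
    proof -
      define h where "h = complex_of_real (k t) / 2"
      have h: "complex_of_real (k t) = 2 * h" "2 * h / 2 = h" by (simp_all add: h_def)
      show ?thesis
        unfolding \<xi>\<^sub>3_def \<xi>\<^sub>2_def h
      proof (rule pencil_polynomial_identity)
        show "h * (1 + \<xi> t * cnj (\<xi> t)) = 1" using r1[unfolded h(1)] by (simp add: mult.assoc)
        show "4 * h\<^sup>2 * (\<xi>' t * cnj (\<xi>' t)) = 1" using r2[unfolded h(1)] by algebra
        show "complex_of_real (w' t $ 3) = - 2 * h\<^sup>2 * (cnj (\<xi> t) * \<xi>' t + \<xi> t * cnj (\<xi>' t))"
          using r3[unfolded h(1)] by algebra
        show "cnj (f q t) = 2 * of_real (q \<bullet> w' t) - f q t" using fB by algebra
      qed
    qed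
  qed
qed

end

lemma great_circle_rotate:
  assumes "great_circle w w'" "rotation_matrix R"
  shows "great_circle (\<lambda>t. w t v* R) (\<lambda>t. w' t v* R)"
proof -
  interpret great_circle w w' by fact
  note bl = bounded_linear.has_vector_derivative[OF matrix_vector_mul_bounded_linear[of "transpose R"]]
  show ?thesis
  proof
    fix t
    show "((\<lambda>t. w t v* R) has_vector_derivative w' t v* R) (at t)"
      using bl[OF w] by simp
    have "(- w t) v* R = - (w t v* R)"
      by (simp add: vec_eq_iff vector_matrix_mult_def sum_negf)
    then show "((\<lambda>t. w' t v* R) has_vector_derivative - (w t v* R)) (at t)"
      using bl[OF w'[of t]] by simp
  qed (simp_all add: rotation_matrix_inverse[OF assms(2)] orthonormal)
qed

lemma pencil_line_geodesic:
  assumes "great_circle u u'"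
  shows "line_geodesic (\<lambda>t. (u t, p - (p \<bullet> u t) *\<^sub>R u t))" (is "line_geodesic ?\<gamma>")
proof -
  interpret U: great_circle u u' by fact
  have lines: "?\<gamma> t \<in> oriented_lines" for t
    using U.orthonormal(1)[of t]
    by (simp add: oriented_lines_def norm_eq_1 inner_diff_right inner_commute)
  show ?thesis
    unfolding line_geodesic_def
  proof (intro conjI allI impI)
    show "range ?\<gamma> \<subseteq> oriented_lines" using lines by blast
    \<comment> \<open>The coordinates about the pole of \<open>R\<close> are those about the north pole of the pencil that is
      rotated back, which is again a pencil.\<close>
    fix R t
    assume *: "rotation_matrix R \<and> ?\<gamma> t \<in> range (line_chart R)"
    then have R: "rotation_matrix R" by blast
    interpret great_circle "\<lambda>t. u t v* R" "\<lambda>t. u' t v* R"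
      by (rule great_circle_rotate[OF assms R])
    define q where "q = p v* R"
    let ?w = "\<lambda>t. u t v* R" and ?w' = "\<lambda>t. u' t v* R"
    have kt: "k t \<noteq> 0"
      using * line_chart_nonantipodal[OF R] unfolding k_def by blast
    then have near: "\<forall>\<^sub>F s in nhds t. k s \<noteq> 0"
      using eventually_nhds open_k by fast
    let ?c = "\<lambda>s. (\<xi> s, f q s * \<xi>' s)"
    let ?c' = "\<lambda>s. (\<xi>' s, - of_real (q \<bullet> ?w s) * \<xi>' s + f q s * \<xi>\<^sub>2 s)"
    let ?c'' = "(\<xi>\<^sub>2 t, - of_real (q \<bullet> ?w' t) * \<xi>' t - 2 * of_real (q \<bullet> ?w t) * \<xi>\<^sub>2 t + f q t * \<xi>\<^sub>3 t)"
    have chart: "?\<gamma> s = line_chart R (?c s)" if "k s \<noteq> 0" for s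
    proof -
      have "q \<bullet> ?w s = p \<bullet> u s"
        unfolding q_def by (rule rotation_matrix_inverse(3)[OF R])
      then have "(p - (p \<bullet> u s) *\<^sub>R u s) v* R = q - (q \<bullet> ?w s) *\<^sub>R ?w s"
        by (simp add: q_def matrix_vector_mult_diff_distrib
            matrix_vector_mult_scaleR flip: transpose_matrix_vector)
      then show ?thesis
        using line_coords_pencil[OF that, of q] line_chart_line_coords[OF R, of "u s" "p - (p \<bullet> u s) *\<^sub>R u s"]
          lines[of s] that by (simp add: oriented_lines_def k_def f_def)
    qed
    have c: "(?c has_vector_derivative ?c' s) (at s)" if "k s \<noteq> 0" for s
    proof (rule has_vector_derivative_Pair[OF \<xi>_derivative[OF that]])
      show "((\<lambda>s. f q s * \<xi>' s) has_vector_derivative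
          - of_real (q \<bullet> ?w s) * \<xi>' s + f q s * \<xi>\<^sub>2 s) (at s)"
        using has_vector_derivative_mult[OF f_derivative \<xi>'_derivative[OF that]]
        by (simp add: \<xi>\<^sub>2_def algebra_simps)
    qed
    have c': "(?c' has_vector_derivative ?c'') (at t)"
    proof (rule has_vector_derivative_Pair)
      show d: "(\<xi>' has_vector_derivative \<xi>\<^sub>2 t) (at t)"
        using \<xi>'_derivative[OF kt] by (simp add: \<xi>\<^sub>2_def)
      have A: "((\<lambda>s. complex_of_real (q \<bullet> ?w s)) has_vector_derivative of_real (q \<bullet> ?w' t)) (at t)"
        using bounded_linear.has_vector_derivative[OF bounded_linear_compose[OF bounded_linear_of_real
              bounded_linear_inner_right] w] .
      show "((\<lambda>s. - of_real (q \<bullet> ?w s) * \<xi>' s + f q s * \<xi>\<^sub>2 s) has_vector_derivative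
          - of_real (q \<bullet> ?w' t) * \<xi>' t - 2 * of_real (q \<bullet> ?w t) * \<xi>\<^sub>2 t + f q t * \<xi>\<^sub>3 t) (at t)"
        using has_vector_derivative_add[OF has_vector_derivative_mult[OF has_vector_derivative_minus[OF A] d]
            has_vector_derivative_mult[OF f_derivative[of q] \<xi>\<^sub>2_derivative[OF kt]]]
        by (simp add: algebra_simps)
    qed
    show "\<exists>c c' c''.
          (\<forall>\<^sub>F s in nhds t. ?\<gamma> s = line_chart R (c s) \<and> (c has_vector_derivative c' s) (at s)) \<and>
          (c' has_vector_derivative c'') (at t) \<and>
          c'' + christoffel (pullback_metric neutral_metric (line_chart R)) (c t) (c' t) (c' t) = 0"
      unfolding pullback_neutral_metric[OF R]
      by (rule exI[of _ ?c], rule exI[of _ ?c'], rule exI[of _ ?c''])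
        (intro conjI eventually_mono[OF near] chart c c' christoffel_pencil[OF kt])
  qed
qed


section \<open>Tangent planes of a surface\<close>

lemma local_parametrizationD:
  assumes "local_parametrization \<phi> U M"
  shows "open U" "smooth_on \<phi> U" "x \<in> U \<Longrightarrow> inj (frechet_derivative \<phi> (at x))"
    and "openin (top_of_set M) (\<phi> ` U)" "\<exists>\<psi>. homeomorphism U (\<phi> ` U) \<phi> \<psi>" "\<phi> ` U \<subseteq> M"
    and "x \<in> U \<Longrightarrow> (\<phi> has_derivative frechet_derivative \<phi> (at x)) (at x)"
  using assms openin_imp_subset smooth_on_has_derivative unfolding local_parametrization_def by blast+

lemma isCont_eventually_in_open:
  assumes "isCont c t" "open U" "c t \<in> U"
  shows "\<forall>\<^sub>F s in nhds t. c s \<in> U"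
  using topological_tendstoD[OF assms(1)[unfolded continuous_at] assms(2,3)] assms(3)
  by (simp add: eventually_nhds_conv_at)

lemma derivative_in_tangent_space:
  assumes \<phi>: "local_parametrization \<phi> U M" "x \<in> U"
  shows "frechet_derivative \<phi> (at x) a \<in> tangent_space M (\<phi> x)"
proof -
  have l: "((\<lambda>t::real. x + t *\<^sub>R a) has_vector_derivative a) (at 0)"
    by (auto intro!: derivative_eq_intros)
  have "((\<lambda>t. \<phi> (x + t *\<^sub>R a)) has_vector_derivative frechet_derivative \<phi> (at x) a) (at 0)"
    using vector_derivative_diff_chain_within[OF l, of \<phi> "frechet_derivative \<phi> (at x)"]
      local_parametrizationD(7)[OF \<phi>] by (simp add: o_def has_derivative_at_withinI)
  moreover have "\<forall>\<^sub>F t in nhds 0. \<phi> (x + t *\<^sub>R a) \<in> M"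
  proof -
    have "isCont (\<lambda>t::real. x + t *\<^sub>R a) 0" by (intro continuous_intros)
    then have "\<forall>\<^sub>F t in nhds 0. x + t *\<^sub>R a \<in> U"
      by (rule isCont_eventually_in_open[OF _ local_parametrizationD(1)[OF \<phi>(1)]]) (simp add: \<phi>(2))
    then show ?thesis
      by (rule eventually_mono) (use local_parametrizationD(6)[OF \<phi>(1)] in blast)
  qed
  ultimately show ?thesis
    unfolding tangent_space_def by (intro CollectI exI[of _ "\<lambda>t. \<phi> (x + t *\<^sub>R a)"]) simp
qed

text \<open>The range of the derivative of a chart is a plane inside the tangent space, and so it exhausts any
  plane that contains the tangent space.\<close>

lemma tangent_space_eq_hyperplane:
  fixes \<phi> :: "real \<times> real \<Rightarrow> real^3"
  assumes \<phi>: "local_parametrization \<phi> U S" "x \<in> U"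
    and m: "m \<noteq> 0" "tangent_space S (\<phi> x) \<subseteq> {v. m \<bullet> v = 0}"
  shows "tangent_space S (\<phi> x) = {v. m \<bullet> v = 0}" "range (frechet_derivative \<phi> (at x)) = {v. m \<bullet> v = 0}"
proof -
  let ?D = "frechet_derivative \<phi> (at x)"
  have D: "linear ?D" "inj ?D"
    using local_parametrizationD(3,7)[OF \<phi>(1) \<phi>(2)] has_derivative_linear by auto
  have "dim (range ?D) = 2"
    using dim_image_eq[OF D(1), of UNIV] D(2) by (simp add: dim_UNIV)
  moreover have "dim {v. m \<bullet> v = 0} = 2"
    using dim_hyperplane[OF m(1)] by simp
  moreover have sub: "range ?D \<subseteq> tangent_space S (\<phi> x)"
    using derivative_in_tangent_space[OF \<phi>] by blast
  ultimately show *: "range ?D = {v. m \<bullet> v = 0}"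
    using m(2) by (intro subspace_dim_equal linear_subspace_image[OF D(1) subspace_UNIV]
        subspace_hyperplane) auto
  show "tangent_space S (\<phi> x) = {v. m \<bullet> v = 0}"
    using * sub m(2) by blast
qed

text \<open>The second derivative is linear in the direction of the first differentiation, because
  \<open>frechet_derivative \<phi> (at z)\<close> is linear for all \<open>z\<close> near \<open>y\<close>.\<close>

lemma second_derivative_linear:
  assumes "open U" "smooth_on \<phi> U" "y \<in> U"
  shows "frechet_derivative (\<lambda>z. frechet_derivative \<phi> (at z) (\<alpha> *\<^sub>R a + \<beta> *\<^sub>R b)) (at y) h =
    \<alpha> *\<^sub>R frechet_derivative (\<lambda>z. frechet_derivative \<phi> (at z) a) (at y) h +
    \<beta> *\<^sub>R frechet_derivative (\<lambda>z. frechet_derivative \<phi> (at z) b) (at y) h"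
proof -
  let ?d = "\<lambda>a z. frechet_derivative \<phi> (at z) a"
  have "(?d a has_derivative frechet_derivative (?d a) (at y)) (at y)" for a
    using smooth_on_has_derivative[OF smooth_on_derivative[OF assms(2)] assms(3)] .
  then have "((\<lambda>z. \<alpha> *\<^sub>R ?d a z + \<beta> *\<^sub>R ?d b z) has_derivative
      (\<lambda>h. \<alpha> *\<^sub>R frechet_derivative (?d a) (at y) h + \<beta> *\<^sub>R frechet_derivative (?d b) (at y) h)) (at y)"
    by (intro has_derivative_add has_derivative_scaleR_right)
  moreover have "\<alpha> *\<^sub>R ?d a z + \<beta> *\<^sub>R ?d b z = ?d (\<alpha> *\<^sub>R a + \<beta> *\<^sub>R b) z" if "z \<in> U" for z
    using has_derivative_linear[OF smooth_on_has_derivative[OF assms(2) that]]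
    by (simp add: linear_add linear_scale)
  ultimately have "(?d (\<alpha> *\<^sub>R a + \<beta> *\<^sub>R b) has_derivative
      (\<lambda>h. \<alpha> *\<^sub>R frechet_derivative (?d a) (at y) h + \<beta> *\<^sub>R frechet_derivative (?d b) (at y) h)) (at y)"
    by (rule has_derivative_transform_within_open[OF _ assms(1,3)])
  from frechet_derivative_at[OF this, symmetric] show ?thesis
    by (rule fun_cong)
qed

text \<open>A point with positive definite second fundamental form is a strict local minimum of the
  height above the tangent plane: along a short segment from \<open>x\<close> with direction \<open>h\<close>, the slope of
  the height is \<open>\<theta> Q(h) + o(\<theta> \<parallel>h\<parallel>\<^sup>2)\<close> at the parameter \<open>\<theta>\<close>, where \<open>Q\<close> is bounded below
  by compactness of the circle of directions.\<close>

lemma positive_definite_imp_strict_local_minimum: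
  fixes \<phi> :: "real \<times> real \<Rightarrow> 'a::euclidean_space"
  assumes U: "open U" "smooth_on \<phi> U" "x \<in> U"
    and crit: "\<And>a. n \<bullet> frechet_derivative \<phi> (at x) a = 0"
    and pos: "\<And>a. a \<noteq> 0 \<Longrightarrow> n \<bullet> frechet_derivative (\<lambda>y. frechet_derivative \<phi> (at y) a) (at x) a > 0"
  shows "\<exists>\<epsilon>>0. \<forall>y\<in>ball x \<epsilon>. y \<in> U \<and> (y \<noteq> x \<longrightarrow> n \<bullet> \<phi> x < n \<bullet> \<phi> y)"
proof -
  let ?d = "\<lambda>a z. frechet_derivative \<phi> (at z) a"
  \<comment> \<open>the gradient of the height and its derivative at \<open>x\<close>\<close>
  define F where "F y = (n \<bullet> ?d (1, 0) y, n \<bullet> ?d (0, 1) y)" for y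
  define L where "L h = (n \<bullet> frechet_derivative (?d (1, 0)) (at x) h,
    n \<bullet> frechet_derivative (?d (0, 1)) (at x) h)" for h
  have dec: "h = fst h *\<^sub>R (1, 0) + snd h *\<^sub>R (0, 1)" for h :: "real \<times> real"
    by (cases h) simp
  have F: "F y \<bullet> h = n \<bullet> ?d h y" if "y \<in> U" for y h
  proof -
    have "?d h y = fst h *\<^sub>R ?d (1, 0) y + snd h *\<^sub>R ?d (0, 1) y"
      using has_derivative_linear[OF smooth_on_has_derivative[OF U(2) that]]
      by (subst dec[of h]) (simp only: linear_add linear_scale)
    then show ?thesis by (simp add: F_def inner_prod_def inner_add_right algebra_simps)
  qed
  have L: "L h \<bullet> h = n \<bullet> frechet_derivative (?d h) (at x) h" for h
    using second_derivative_linear[OF U, of "fst h" "(1, 0)" "snd h" "(0, 1)" h, folded dec]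
    by (simp add: L_def inner_prod_def inner_add_right algebra_simps)
  have FL: "(F has_derivative L) (at x)"
    unfolding F_def[abs_def] L_def[abs_def]
    by (intro has_derivative_Pair has_derivative_inner_right
        smooth_on_has_derivative[OF smooth_on_derivative[OF U(2)] U(3)])
  have F0: "F x = 0"
    using crit by (simp add: F_def zero_prod_def)
  obtain \<mu> where \<mu>: "\<mu> > 0" "\<And>h. L h \<bullet> h \<ge> \<mu> * (norm h)\<^sup>2"
  proof -
    have lin: "linear L" using FL has_derivative_linear by blast
    have "continuous_on (sphere 0 1) (\<lambda>h. L h \<bullet> h)"
      using linear_continuous_on[OF has_derivative_bounded_linear[OF FL]] by (intro continuous_intros) auto
    moreover have "(1, 0) \<in> sphere (0 :: real \<times> real) 1" by (simp add: norm_prod_def)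
    ultimately obtain h0 where h0: "h0 \<in> sphere 0 1" "\<forall>h\<in>sphere 0 1. L h0 \<bullet> h0 \<le> L h \<bullet> h"
      using continuous_attains_inf[OF compact_sphere, of "0::real \<times> real" 1] by blast
    show thesis
    proof
      have "h0 \<noteq> 0" using h0(1) by auto
      then show "L h0 \<bullet> h0 > 0" unfolding L by (rule pos)
      show "L h \<bullet> h \<ge> L h0 \<bullet> h0 * (norm h)\<^sup>2" for h
      proof (cases "h = 0")
        case False
        then have "h /\<^sub>R norm h \<in> sphere 0 1" by simp
        with h0(2) have "L h0 \<bullet> h0 \<le> L (h /\<^sub>R norm h) \<bullet> (h /\<^sub>R norm h)" by blast
        also have "\<dots> = L h \<bullet> h / (norm h)\<^sup>2"
          by (simp add: linear_scale[OF lin] power2_eq_square divide_inverse)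
        finally show ?thesis using False by (simp add: pos_le_divide_eq)
      qed (simp add: lin)
    qed
  qed
  obtain d where d: "d > 0" "\<And>y. norm (y - x) < d \<Longrightarrow> norm (F y - F x - L (y - x)) \<le> \<mu> / 2 * norm (y - x)"
    using has_derivative_at_alt[of F L x] FL \<mu>(1) by (meson half_gt_zero)
  obtain e where e: "e > 0" "ball x e \<subseteq> U" using U open_contains_ball by blast
  have "n \<bullet> \<phi> x < n \<bullet> \<phi> y" if y: "y \<in> ball x (min d e)" "y \<noteq> x" for y
  proof -
    define h where "h = y - x"
    have h: "h \<noteq> 0" "norm h < d" "norm h < e" using y by (auto simp: h_def dist_norm norm_minus_commute)
    have in_U: "x + t *\<^sub>R h \<in> U" and small: "norm (t *\<^sub>R h) < d" if "0 \<le> t" "t \<le> 1" for t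
    proof -
      have "norm (t *\<^sub>R h) \<le> norm h" using that by (simp add: mult_left_le_one_le)
      then have "norm (t *\<^sub>R h) < d" "norm (t *\<^sub>R h) < e" using h by linarith+
      then show "x + t *\<^sub>R h \<in> U" "norm (t *\<^sub>R h) < d"
        using subsetD[OF e(2), of "x + t *\<^sub>R h"] by (simp_all add: dist_norm)
    qed
    have g: "((\<lambda>t. n \<bullet> \<phi> (x + t *\<^sub>R h)) has_real_derivative n \<bullet> ?d h (x + t *\<^sub>R h)) (at t)"
      if "0 \<le> t" "t \<le> 1" for t
    proof -
      have "((\<lambda>t. x + t *\<^sub>R h) has_vector_derivative h) (at t)"
        by (auto intro!: derivative_eq_intros)
      then have "((\<lambda>t. \<phi> (x + t *\<^sub>R h)) has_vector_derivative ?d h (x + t *\<^sub>R h)) (at t)"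
        using vector_derivative_diff_chain_within[of "\<lambda>t. x + t *\<^sub>R h" h t UNIV \<phi>]
          smooth_on_has_derivative[OF U(2) in_U[OF that]] by (simp add: o_def has_derivative_at_withinI)
      then show ?thesis
        unfolding has_real_derivative_iff_has_vector_derivative
        by (rule bounded_linear.has_vector_derivative[OF bounded_linear_inner_right])
    qed
    have "\<exists>t. 0 < t \<and> t < 1 \<and> n \<bullet> \<phi> (x + 1 *\<^sub>R h) - n \<bullet> \<phi> (x + 0 *\<^sub>R h) = (1 - 0) * (n \<bullet> ?d h (x + t *\<^sub>R h))"
      by (rule MVT2) (auto intro: g)
    then obtain t where t: "0 < t" "t < 1" "n \<bullet> \<phi> y - n \<bullet> \<phi> x = F (x + t *\<^sub>R h) \<bullet> h"
      using F in_U by (auto simp: h_def)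
    have "\<bar>(F (x + t *\<^sub>R h) - L (t *\<^sub>R h)) \<bullet> h\<bar> \<le> norm (F (x + t *\<^sub>R h) - L (t *\<^sub>R h)) * norm h"
      by (rule Cauchy_Schwarz_ineq2)
    also have "\<dots> \<le> (\<mu> / 2 * norm (t *\<^sub>R h)) * norm h"
      using d(2)[of "x + t *\<^sub>R h"] small[of t] t F0 by (intro mult_right_mono) auto
    also have "\<dots> = t * (\<mu> / 2 * (norm h)\<^sup>2)"
      using t by (simp add: power2_eq_square)
    finally have "F (x + t *\<^sub>R h) \<bullet> h \<ge> L (t *\<^sub>R h) \<bullet> h - t * (\<mu> / 2 * (norm h)\<^sup>2)"
      unfolding inner_diff_left by linarith
    also have "L (t *\<^sub>R h) \<bullet> h = t * (L h \<bullet> h)"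
      using linear_scale[OF has_derivative_linear[OF FL]] by simp
    finally have "F (x + t *\<^sub>R h) \<bullet> h \<ge> t * (\<mu> * (norm h)\<^sup>2) - t * (\<mu> / 2 * (norm h)\<^sup>2)"
      using mult_left_mono[OF \<mu>(2)[of h], of t] t by linarith
    also have "t * (\<mu> * (norm h)\<^sup>2) - t * (\<mu> / 2 * (norm h)\<^sup>2) = t * (\<mu> / 2 * (norm h)\<^sup>2)"
      by (simp add: algebra_simps)
    finally have "F (x + t *\<^sub>R h) \<bullet> h \<ge> t * (\<mu> / 2 * (norm h)\<^sup>2)" .
    moreover have "t * (\<mu> / 2 * (norm h)\<^sup>2) > 0" using t \<mu>(1) h(1) by simp
    ultimately show ?thesis using t(3) by linarith
  qed
  then show ?thesis using d(1) e by (intro exI[of _ "min d e"]) auto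
qed


section \<open>Tangent lines of a strictly convex surface\<close>

locale convex_surface =
  fixes S K :: "(real^3) set"
  assumes submanifold: "smooth_submanifold TYPE(real \<times> real) S"
    and body: "compact K" "convex K" "interior K \<noteq> {}" "S = frontier K"
    and definite: "\<And>p. p \<in> S \<Longrightarrow> \<exists>n. norm n = 1 \<and> (\<forall>v\<in>tangent_space S p. n \<bullet> v = 0) \<and>
        (\<forall>(\<phi>::real \<times> real \<Rightarrow> real^3) U x a.
           local_parametrization \<phi> U S \<and> x \<in> U \<and> \<phi> x = p \<and> a \<noteq> 0 \<longrightarrow>
           n \<bullet> frechet_derivative (\<lambda>y. frechet_derivative \<phi> (at y) a) (at x) a > 0)"
begin

lemma S_subset: "S \<subseteq> K" and S_interior: "p \<in> S \<Longrightarrow> p \<notin> interior K"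
  and S_I: "p \<in> K \<Longrightarrow> p \<notin> interior K \<Longrightarrow> p \<in> S"
proof -
  have "closure K = K" using body(1) compact_imp_closed closure_closed by blast
  then show "S \<subseteq> K" "p \<in> S \<Longrightarrow> p \<notin> interior K" "p \<in> K \<Longrightarrow> p \<notin> interior K \<Longrightarrow> p \<in> S"
    using body(4) by (auto simp: frontier_def)
qed

lemma compact_S: "compact S"
  using body compact_frontier by blast

lemma chart_at:
  assumes "p \<in> S"
  obtains \<phi> :: "real \<times> real \<Rightarrow> real^3" and U x where "local_parametrization \<phi> U S" "x \<in> U" "\<phi> x = p"
proof -
  obtain \<phi> :: "real \<times> real \<Rightarrow> real^3" and U where "local_parametrization \<phi> U S" "p \<in> \<phi> ` U"
    using submanifold assms unfolding smooth_submanifold_def by blast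
  with that show thesis by blast
qed

definition normal :: "real^3 \<Rightarrow> real^3" where
  "normal p = (SOME n. norm n = 1 \<and> (\<forall>v\<in>tangent_space S p. n \<bullet> v = 0) \<and>
        (\<forall>(\<phi>::real \<times> real \<Rightarrow> real^3) U x a.
           local_parametrization \<phi> U S \<and> x \<in> U \<and> \<phi> x = p \<and> a \<noteq> 0 \<longrightarrow>
           n \<bullet> frechet_derivative (\<lambda>y. frechet_derivative \<phi> (at y) a) (at x) a > 0))"

lemma normal:
  assumes "p \<in> S"
  shows "norm (normal p) = 1" "v \<in> tangent_space S p \<Longrightarrow> normal p \<bullet> v = 0"
    and "\<And>(\<phi>::real \<times> real \<Rightarrow> real^3) U x a.
      local_parametrization \<phi> U S \<Longrightarrow> x \<in> U \<Longrightarrow> \<phi> x = p \<Longrightarrow> a \<noteq> 0 \<Longrightarrow>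
      normal p \<bullet> frechet_derivative (\<lambda>y. frechet_derivative \<phi> (at y) a) (at x) a > 0"
  using someI_ex[OF definite[OF assms], folded normal_def] by blast+

lemma tangent_space_eq:
  assumes "p \<in> S" "m \<noteq> 0" "tangent_space S p \<subseteq> {v. m \<bullet> v = 0}"
  shows "tangent_space S p = {v. m \<bullet> v = 0}"
proof -
  obtain \<phi> :: "real \<times> real \<Rightarrow> real^3" and U x where "local_parametrization \<phi> U S" "x \<in> U" "\<phi> x = p"
    using chart_at[OF assms(1)] .
  with tangent_space_eq_hyperplane(1)[of \<phi> U S x m] assms(2,3) show ?thesis by simp
qed

lemma tangent_space_normal: "p \<in> S \<Longrightarrow> tangent_space S p = {v. normal p \<bullet> v = 0}"
  using normal(1,2)[of p] by (intro tangent_space_eq) auto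

lemma range_chart_derivative:
  fixes \<phi> :: "real \<times> real \<Rightarrow> real^3"
  assumes "local_parametrization \<phi> U S" "x \<in> U"
  shows "range (frechet_derivative \<phi> (at x)) = {v. normal (\<phi> x) \<bullet> v = 0}"
proof -
  have "\<phi> x \<in> S" using local_parametrizationD(6)[OF assms(1)] assms(2) by blast
  then show ?thesis
    using normal(1,2)[of "\<phi> x"] by (intro tangent_space_eq_hyperplane(2)[OF assms]) auto
qed

text \<open>A supporting plane at \<open>p\<close> is tangent, since its height function is minimal at \<open>p\<close> on \<open>S\<close>.\<close>

lemma supporting_imp_orthogonal:
  assumes p: "p \<in> S" and m: "\<And>x. x \<in> K \<Longrightarrow> m \<bullet> p \<le> m \<bullet> x" and v: "v \<in> tangent_space S p"
  shows "m \<bullet> v = 0"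
proof -
  obtain c where c: "c 0 = p" "\<forall>\<^sub>F t in nhds 0. c t \<in> S" "(c has_vector_derivative v) (at (0::real))"
    using v unfolding tangent_space_def by blast
  obtain A where A: "open A" "0 \<in> A" "\<And>t. t \<in> A \<Longrightarrow> c t \<in> S"
    using c(2) unfolding eventually_nhds by blast
  then obtain d where d: "d > 0" "ball 0 d \<subseteq> A" using open_contains_ball by blast
  have "((\<lambda>t. m \<bullet> c t) has_real_derivative m \<bullet> v) (at 0)"
    unfolding has_real_derivative_iff_has_vector_derivative
    using bounded_linear.has_vector_derivative[OF bounded_linear_inner_right c(3)] .
  then show ?thesis
  proof (rule DERIV_local_min[OF _ d(1)], intro allI impI)
    fix y :: real
    assume "\<bar>0 - y\<bar> < d"
    then have "y \<in> A" using d(2) by (auto simp: dist_real_def)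
    then show "m \<bullet> c 0 \<le> m \<bullet> c y" using A(3) m S_subset c(1) by auto
  qed
qed

text \<open>A line through \<open>p \<in> S\<close> is tangent to \<open>S\<close> if and only if it avoids the interior of the body.
  This makes tangency a closed condition and allows one to test it on curves of lines
  without following the point of tangency.\<close>

lemma tangent_iff_avoids_interior:
  assumes p: "p \<in> S"
  shows "u \<in> tangent_space S p \<longleftrightarrow> (\<forall>r. p + r *\<^sub>R u \<notin> interior K)"
proof
  assume u: "u \<in> tangent_space S p"
  have rel: "rel_interior K = interior K" by (rule rel_interior_nonempty_interior[OF body(3)])
  have pK: "p \<in> closure K" "p \<notin> rel_interior K"
    unfolding rel using p S_subset S_interior closure_subset by blast+
  obtain m where m: "m \<noteq> 0" "\<And>x. x \<in> closure K \<Longrightarrow> m \<bullet> p \<le> m \<bullet> x"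
    "\<And>x. x \<in> interior K \<Longrightarrow> m \<bullet> p < m \<bullet> x"
    using supporting_hyperplane_relative_frontier[OF body(2) pK] unfolding rel by blast
  have m2: "m \<bullet> p \<le> m \<bullet> x" if "x \<in> K" for x
    using m(2)[OF subsetD[OF closure_subset that]] .
  have "m \<bullet> u = 0" using supporting_imp_orthogonal[OF p m2 u] .
  then show "\<forall>r. p + r *\<^sub>R u \<notin> interior K"
    using m(3) by (fastforce simp: inner_add_right)
next
  assume avoid: "\<forall>r. p + r *\<^sub>R u \<notin> interior K"
  let ?L = "range (\<lambda>r. p + r *\<^sub>R u)"
  have "convex ?L"
  proof -
    have "?L = (+) p ` span {u}" by (auto simp: span_singleton)
    then show ?thesis using convex_translation[OF subspace_imp_convex[OF subspace_span]] by simp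
  qed
  then obtain a b where ab: "a \<noteq> 0" "\<forall>x\<in>?L. a \<bullet> x \<le> b" "\<forall>x\<in>interior K. a \<bullet> x \<ge> b"
    using separating_hyperplane_sets[of ?L "interior K"] body(2,3) avoid convex_interior by blast
  have "K \<subseteq> closure (interior K)"
    using convex_closure_interior[OF body(2,3)] closure_subset by blast
  also have "\<dots> \<subseteq> {x. a \<bullet> x \<ge> b}"
    using ab(3) by (intro closure_minimal) (auto simp: closed_halfspace_ge)
  finally have K: "a \<bullet> x \<ge> b" if "x \<in> K" for x using that by blast
  have "p + 0 *\<^sub>R u \<in> ?L" by blast
  then have "a \<bullet> (p + 0 *\<^sub>R u) \<le> b" using ab(2) by blast
  then have b: "a \<bullet> p = b" using K[of p] p S_subset by auto
  have "p + 1 *\<^sub>R u \<in> ?L" "p + (- 1) *\<^sub>R u \<in> ?L" by blast+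
  then have "a \<bullet> (p + 1 *\<^sub>R u) \<le> b" "a \<bullet> (p + (- 1) *\<^sub>R u) \<le> b" using ab(2) by blast+
  then have au: "a \<bullet> u = 0" using b by (simp add: inner_add_right inner_diff_right)
  have "tangent_space S p \<subseteq> {v. a \<bullet> v = 0}"
    using supporting_imp_orthogonal[OF p, of a] K b by auto
  then show "u \<in> tangent_space S p"
    using tangent_space_eq[OF p ab(1)] au by blast
qed

text \<open>If \<open>p + r d\<close> is an interior point, then so are the points \<open>z t\<close>, where \<open>t / r\<close> is positive
  and small: they lie on segments from \<open>p\<close> to points near \<open>p + r d\<close>.\<close>

lemma velocity_tangent_if_avoids_interior:
  assumes p: "p \<in> S" and z: "z 0 = p" "(z has_vector_derivative d) (at (0::real))"
    and avoid: "\<forall>\<^sub>F t in nhds 0. z t \<notin> interior K"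
  shows "d \<in> tangent_space S p"
  unfolding tangent_iff_avoids_interior[OF p]
proof (intro allI notI)
  fix r assume r: "p + r *\<^sub>R d \<in> interior K"
  then have r0: "r \<noteq> 0" using S_interior[OF p] by auto
  have "((\<lambda>t. (z t - p) /\<^sub>R t) \<longlongrightarrow> d) (at 0)"
  proof (rule Lim_null[THEN iffD2], rule tendsto_norm_zero_cancel, rule Lim_transform_eventually)
    show "((\<lambda>t. norm (z (0 + t) - z 0 - t *\<^sub>R d) / norm t) \<longlongrightarrow> 0) (at 0)"
      using z(2) unfolding has_vector_derivative_def has_derivative_at by blast
    show "\<forall>\<^sub>F t in at 0. norm (z (0 + t) - z 0 - t *\<^sub>R d) / norm t = norm ((z t - p) /\<^sub>R t - d)"
      unfolding eventually_at_filter
    proof (rule always_eventually, intro allI impI)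
      fix t :: real assume "t \<noteq> 0"
      then have "(z t - p) /\<^sub>R t - d = (z t - p - t *\<^sub>R d) /\<^sub>R t" by (simp add: scaleR_diff_right)
      then show "norm (z (0 + t) - z 0 - t *\<^sub>R d) / norm t = norm ((z t - p) /\<^sub>R t - d)"
        by (simp add: z(1) divide_inverse)
    qed
  qed
  then have "((\<lambda>t. p + r *\<^sub>R ((z t - p) /\<^sub>R t)) \<longlongrightarrow> p + r *\<^sub>R d) (at 0)"
    by (intro tendsto_intros)
  then have 1: "\<forall>\<^sub>F t in at 0. p + r *\<^sub>R ((z t - p) /\<^sub>R t) \<in> interior K"
    using r by (rule topological_tendstoD[OF _ open_interior])
  have "((\<lambda>t. t / r) \<longlongrightarrow> 0 / r) (at (0::real))"
    by (intro tendsto_intros) (rule r0)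
  then have 2: "\<forall>\<^sub>F t in at 0. t / r < 1"
    by (rule order_tendstoD) simp
  have "\<forall>\<^sub>F t in at 0. z t \<notin> interior K"
    using avoid by (simp add: eventually_nhds_conv_at)
  with 1 2 have "\<forall>\<^sub>F t in at (0::real). \<not> t / r > 0"
  proof eventually_elim
    case (elim t)
    show ?case
    proof
      assume t: "t / r > 0"
      let ?y = "p + r *\<^sub>R ((z t - p) /\<^sub>R t)"
      have "p - (t / r) *\<^sub>R (p - ?y) \<in> interior K"
        using mem_interior_convex_shrink[OF body(2) elim(1), of p "t / r"] t elim(2) p S_subset by auto
      moreover have "t \<noteq> 0" using t by auto
      then have "p - (t / r) *\<^sub>R (p - ?y) = z t"
        using r0 by (simp add: field_simps)
      ultimately show False using elim(3) by simp
    qed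
  qed
  then obtain e where e: "e > 0" "\<And>t. t \<noteq> 0 \<Longrightarrow> dist t 0 < e \<Longrightarrow> \<not> t / r > 0"
    unfolding eventually_at by auto
  have "dist (e / 2 * sgn r) 0 < e" "e / 2 * sgn r \<noteq> 0" "e / 2 * sgn r / r > 0"
    using e(1) r0 by (auto simp: sgn_if zero_less_mult_iff field_simps split: if_splits)
  with e(2) show False by blast
qed

text \<open>Otherwise the segment between two points of tangency would lie on \<open>S\<close> and in the tangent
  plane, contradicting the strict minimum of the height.\<close>

lemma unique_tangency_point:
  assumes p: "p \<in> S" and q: "p + r *\<^sub>R u \<in> S" and u: "u \<in> tangent_space S p"
  shows "p + r *\<^sub>R u = p"
proof -
  obtain \<phi> :: "real \<times> real \<Rightarrow> real^3" and U x where \<phi>: "local_parametrization \<phi> U S" "x \<in> U" "\<phi> x = p"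
    using chart_at[OF p] .
  note D = local_parametrizationD[OF \<phi>(1)]
  have "\<exists>\<epsilon>>0. \<forall>y\<in>ball x \<epsilon>. y \<in> U \<and> (y \<noteq> x \<longrightarrow> normal p \<bullet> \<phi> x < normal p \<bullet> \<phi> y)"
  proof (rule positive_definite_imp_strict_local_minimum[OF D(1,2) \<phi>(2)])
    show "normal p \<bullet> frechet_derivative \<phi> (at x) a = 0" for a
      using range_chart_derivative[OF \<phi>(1,2)] \<phi>(3) by blast
    show "normal p \<bullet> frechet_derivative (\<lambda>y. frechet_derivative \<phi> (at y) a) (at x) a > 0" if "a \<noteq> 0" for a
      using normal(3)[OF p \<phi> that] .
  qed
  then obtain \<epsilon> where \<epsilon>: "\<epsilon> > 0" "ball x \<epsilon> \<subseteq> U" "\<And>y. y \<in> ball x \<epsilon> \<Longrightarrow> y \<noteq> x \<Longrightarrow> normal p \<bullet> p < normal p \<bullet> \<phi> y"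
    unfolding \<phi>(3) by blast
  have "openin (top_of_set U) (ball x \<epsilon>)" using \<epsilon>(2) by (simp add: open_subset)
  then have "openin (top_of_set (\<phi> ` U)) (\<phi> ` ball x \<epsilon>)"
    using D(5) homeomorphism_imp_open_map by blast
  then have "openin (top_of_set S) (\<phi> ` ball x \<epsilon>)" using D(4) openin_trans by blast
  then obtain W where W: "open W" "\<phi> ` ball x \<epsilon> = S \<inter> W" by (auto simp: openin_open)
  have "x \<in> ball x \<epsilon>" using \<epsilon>(1) by simp
  then have pW: "p \<in> W" using W(2) \<phi>(3) by blast
  have "isCont (\<lambda>t. p + (t * r) *\<^sub>R u) (0::real)" by (intro continuous_intros)
  then have "\<forall>\<^sub>F t in nhds 0. p + (t * r) *\<^sub>R u \<in> W"
    by (rule isCont_eventually_in_open[OF _ W(1)]) (simp add: pW)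
  then obtain e where e: "e > 0" "\<And>t. dist t 0 < e \<Longrightarrow> p + (t * r) *\<^sub>R u \<in> W"
    unfolding eventually_nhds_metric by blast
  define t where "t = min (e / 2) 1"
  have t: "0 < t" "t \<le> 1" "dist t 0 < e" using e(1) by (auto simp: t_def dist_real_def)
  have "p + (t * r) *\<^sub>R u = (1 - t) *\<^sub>R p + t *\<^sub>R (p + r *\<^sub>R u)" by (simp add: algebra_simps)
  then have "p + (t * r) *\<^sub>R u \<in> K"
    using convexD_alt[OF body(2), of p "p + r *\<^sub>R u" t] p q S_subset t by auto
  moreover have "p + (t * r) *\<^sub>R u \<notin> interior K"
    using u unfolding tangent_iff_avoids_interior[OF p] by simp
  ultimately have "p + (t * r) *\<^sub>R u \<in> S" by (rule S_I)
  then have "p + (t * r) *\<^sub>R u \<in> \<phi> ` ball x \<epsilon>" unfolding W(2) using e(2)[OF t(3)] by simp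
  then obtain y where y: "y \<in> ball x \<epsilon>" "\<phi> y = p + (t * r) *\<^sub>R u" by force
  have "normal p \<bullet> \<phi> y = normal p \<bullet> p"
    using normal(2)[OF p u] by (simp add: y(2) inner_add_right)
  then have "y = x" using \<epsilon>(3)[OF y(1)] by (metis less_irrefl)
  then have "(t * r) *\<^sub>R u = 0" using y(2) \<phi>(3) by simp
  then show ?thesis using t(1) by auto
qed

abbreviation "H \<equiv> tangent_hypersurface S"

definition touch :: "(real^3) \<times> (real^3) \<Rightarrow> real^3" where
  "touch = (\<lambda>(u, v). THE p. p \<in> S \<and> u \<in> tangent_space S p \<and> v = p - (p \<bullet> u) *\<^sub>R u)"

lemma H_iff: "(u, v) \<in> H \<longleftrightarrow> norm u = 1 \<and> (\<exists>p\<in>S. u \<in> tangent_space S p \<and> v = p - (p \<bullet> u) *\<^sub>R u)"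
proof
  assume "(u, v) \<in> H"
  then obtain r where r: "norm u = 1" "u \<bullet> v = 0" "v + r *\<^sub>R u \<in> S" "u \<in> tangent_space S (v + r *\<^sub>R u)"
    by (auto simp: tangent_hypersurface_def oriented_lines_def)
  moreover have "(v + r *\<^sub>R u) \<bullet> u = r" using r(1,2) by (simp add: inner_add_left inner_commute[of v u] norm_eq_1)
  ultimately show "norm u = 1 \<and> (\<exists>p\<in>S. u \<in> tangent_space S p \<and> v = p - (p \<bullet> u) *\<^sub>R u)"
    by (intro conjI bexI[of _ "v + r *\<^sub>R u"]) auto
next
  assume "norm u = 1 \<and> (\<exists>p\<in>S. u \<in> tangent_space S p \<and> v = p - (p \<bullet> u) *\<^sub>R u)"
  then obtain p where "norm u = 1" "p \<in> S" "u \<in> tangent_space S p" "v = p - (p \<bullet> u) *\<^sub>R u" by blast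
  then show "(u, v) \<in> H"
    by (auto simp: tangent_hypersurface_def oriented_lines_def norm_eq_1 inner_diff_right inner_commute
        intro!: exI[of _ "p \<bullet> u"])
qed

lemma H_subset: "H \<subseteq> oriented_lines"
  by (auto simp: tangent_hypersurface_def)

lemma touch_eqI:
  assumes p: "p \<in> S" "u \<in> tangent_space S p"
  shows "touch (u, p - (p \<bullet> u) *\<^sub>R u) = p"
  unfolding touch_def prod.case
proof (rule the_equality)
  fix q assume q: "q \<in> S \<and> u \<in> tangent_space S q \<and> p - (p \<bullet> u) *\<^sub>R u = q - (q \<bullet> u) *\<^sub>R u"
  then have *: "p + (q \<bullet> u - p \<bullet> u) *\<^sub>R u = q" by (simp add: algebra_simps)
  show "q = p"
    using unique_tangency_point[OF p(1) _ p(2), of "q \<bullet> u - p \<bullet> u"] q by (simp only: *)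
qed (use p in simp)

lemma touch:
  assumes "(u, v) \<in> H"
  shows "touch (u, v) \<in> S" "u \<in> tangent_space S (touch (u, v))"
    "v = touch (u, v) - (touch (u, v) \<bullet> u) *\<^sub>R u"
proof -
  obtain p where p: "p \<in> S" "u \<in> tangent_space S p" "v = p - (p \<bullet> u) *\<^sub>R u"
    using assms unfolding H_iff by blast
  then have "touch (u, v) = p" using touch_eqI by blast
  with p show "touch (u, v) \<in> S" "u \<in> tangent_space S (touch (u, v))"
    "v = touch (u, v) - (touch (u, v) \<bullet> u) *\<^sub>R u" by simp_all
qed

lemma line_avoids_interior:
  assumes "(u, v) \<in> H"
  shows "v + r *\<^sub>R u \<notin> interior K"
proof -
  let ?p = "touch (u, v)"
  have "v + r *\<^sub>R u = ?p + (r - ?p \<bullet> u) *\<^sub>R u"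
    by (subst touch(3)[OF assms]) (simp add: algebra_simps)
  then show ?thesis
    using touch(2)[OF assms] unfolding tangent_iff_avoids_interior[OF touch(1)[OF assms]] by simp
qed

text \<open>As \<open>S\<close> is compact, it suffices that the graph of \<open>touch\<close> is closed.  It is, because a point of \<open>S\<close> on
  a line in \<open>H\<close> is automatically the point of tangency.\<close>

lemma continuous_touch: "continuous_on H touch"
proof (subst continuous_closed_graph_eq[OF compact_S])
  show "touch \<in> H \<rightarrow> S" using touch(1) by auto
  let ?f = "\<lambda>x :: ((real^3) \<times> (real^3)) \<times> (real^3). snd x - (snd x \<bullet> fst (fst x)) *\<^sub>R fst (fst x) - snd (fst x)"
  have "(\<lambda>l. (l, touch l)) ` H = {x \<in> H \<times> S. ?f x = 0}"
  proof (intro equalityI subsetI)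
    fix x assume "x \<in> (\<lambda>l. (l, touch l)) ` H"
    then obtain u v where x: "x = ((u, v), touch (u, v))" and uv: "(u, v) \<in> H" by auto
    show "x \<in> {x \<in> H \<times> S. ?f x = 0}"
      unfolding x using uv touch(1)[OF uv] touch(3)[OF uv, symmetric] by simp
  next
    fix x assume x: "x \<in> {x \<in> H \<times> S. ?f x = 0}"
    obtain u v p where [simp]: "x = ((u, v), p)" by (metis prod.collapse)
    have uv: "(u, v) \<in> H" and p: "p \<in> S" and v: "v = p - (p \<bullet> u) *\<^sub>R u" using x by auto
    have "p + r *\<^sub>R u \<notin> interior K" for r
    proof -
      have "p + r *\<^sub>R u = v + (r + p \<bullet> u) *\<^sub>R u" unfolding v by (simp add: algebra_simps)
      then show ?thesis using line_avoids_interior[OF uv, of "r + p \<bullet> u"] by simp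
    qed
    then have "u \<in> tangent_space S p" using tangent_iff_avoids_interior[OF p] by blast
    then have "touch (u, v) = p" unfolding v by (rule touch_eqI[OF p])
    then show "x \<in> (\<lambda>l. (l, touch l)) ` H" using uv by force
  qed
  moreover have "closedin (top_of_set (H \<times> S)) {x \<in> H \<times> S. ?f x = 0}"
    by (intro continuous_closedin_preimage_constant continuous_intros)
  ultimately show "closedin (top_of_set (H \<times> S)) ((\<lambda>l. (l, touch l)) ` H)" by simp
qed

end


section \<open>Foliated charts of the tangent hypersurface\<close>

lemma local_parametrization_subset:
  assumes \<phi>: "local_parametrization \<phi> U M" and V: "open V" "V \<subseteq> U"
  shows "local_parametrization \<phi> V M"
proof -
  note D = local_parametrizationD[OF \<phi>]
  obtain \<psi> where \<psi>: "homeomorphism U (\<phi> ` U) \<phi> \<psi>" using D(5) by blast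
  have "openin (top_of_set U) V" using V by (simp add: open_subset)
  then have "openin (top_of_set M) (\<phi> ` V)"
    using homeomorphism_imp_open_map[OF \<psi>] D(4) openin_trans by blast
  moreover have "homeomorphism V (\<phi> ` V) \<phi> \<psi>"
    using homeomorphism_of_subsets[OF \<psi> V(2) _ refl] V(2) by blast
  ultimately show ?thesis
    using V D(2,3) smooth_on_subset unfolding local_parametrization_def by blast
qed

locale surface_chart = convex_surface +
  fixes \<phi> :: "real \<times> real \<Rightarrow> real^3" and U :: "(real \<times> real) set" and a :: "real \<times> real"
  assumes chart: "local_parametrization \<phi> U S" and a: "a \<noteq> 0"
begin

text \<open>\<open>a\<close> rotated by a right angle, so that \<open>a\<close>, \<open>b\<close> is a basis.\<close>

definition b :: "real \<times> real" where "b = (- snd a, fst a)"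

definition X where "X c y = frechet_derivative \<phi> (at y) c"

definition W where "W z = X a (snd z) + fst z *\<^sub>R X b (snd z)"

definition direction where "direction z = inverse (norm (W z)) *\<^sub>R W z"

text \<open>The line of \<open>\<Psi> (s, y)\<close> touches \<open>S\<close> at \<open>\<phi> y\<close> and has the direction of \<open>X a y + s *\<^sub>R X b y\<close>.  So
  the first parameter runs through an open half circle of the pencil at \<open>\<phi> y\<close>, and the directions are
  rational in \<open>s\<close> up to normalization.\<close>

definition \<Psi> where
  "\<Psi> z = (direction z, \<phi> (snd z) - (\<phi> (snd z) \<bullet> direction z) *\<^sub>R direction z)"

lemma basis: "\<exists>\<alpha> \<beta>. h = \<alpha> *\<^sub>R a + \<beta> *\<^sub>R b"
proof -
  define j where "j = inverse (a \<bullet> a)"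
  have "j * (a \<bullet> a) = 1" using a by (simp add: j_def)
  then have j: "j * (fst a * fst a + snd a * snd a) = 1" by (simp add: inner_prod_def)
  have "h = (j * (h \<bullet> a)) *\<^sub>R a + (j * (h \<bullet> b)) *\<^sub>R b"
    unfolding prod_eq_iff
  proof (intro conjI)
    show "fst h = fst ((j * (h \<bullet> a)) *\<^sub>R a + (j * (h \<bullet> b)) *\<^sub>R b)"
      using j by (simp add: b_def inner_prod_def) algebra
    show "snd h = snd ((j * (h \<bullet> a)) *\<^sub>R a + (j * (h \<bullet> b)) *\<^sub>R b)"
      using j by (simp add: b_def inner_prod_def) algebra
  qed
  then show ?thesis by blast
qed

lemma independent: "\<alpha> *\<^sub>R a + \<beta> *\<^sub>R b = 0 \<Longrightarrow> \<alpha> = 0 \<and> \<beta> = 0"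
proof -
  assume *: "\<alpha> *\<^sub>R a + \<beta> *\<^sub>R b = 0"
  have ab: "a \<bullet> b = 0" "b \<bullet> b = a \<bullet> a" by (simp_all add: b_def inner_prod_def)
  have "a \<bullet> (\<alpha> *\<^sub>R a + \<beta> *\<^sub>R b) = 0" "b \<bullet> (\<alpha> *\<^sub>R a + \<beta> *\<^sub>R b) = 0" unfolding * by simp_all
  then show ?thesis using a by (simp add: inner_add_right ab inner_commute[of b a])
qed

lemmas chartD = local_parametrizationD[OF chart]

lemma X_linear: "y \<in> U \<Longrightarrow> \<alpha> *\<^sub>R X c y + \<beta> *\<^sub>R X d y = X (\<alpha> *\<^sub>R c + \<beta> *\<^sub>R d) y"
  using has_derivative_linear[OF chartD(7)] by (simp add: X_def linear_add linear_scale)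

lemma X_inj: "y \<in> U \<Longrightarrow> X c y = X d y \<Longrightarrow> c = d"
  using chartD(3) unfolding X_def by (blast dest: injD)

lemma X_eq_0: "y \<in> U \<Longrightarrow> X c y = 0 \<Longrightarrow> c = 0"
  using X_inj[of y c 0] X_linear[of y 0 0 0 0] by simp

lemma chart_in_S: "y \<in> U \<Longrightarrow> \<phi> y \<in> S"
  using chartD(6) by blast

lemma X_tangent: "y \<in> U \<Longrightarrow> X c y \<in> tangent_space S (\<phi> y)"
  unfolding X_def by (rule derivative_in_tangent_space[OF chart])

lemma tangent_eq_X:
  assumes "y \<in> U" "u \<in> tangent_space S (\<phi> y)"
  shows "\<exists>\<alpha> \<beta>. u = \<alpha> *\<^sub>R X a y + \<beta> *\<^sub>R X b y"
proof -
  have "u \<in> range (frechet_derivative \<phi> (at y))"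
    using assms range_chart_derivative[OF chart assms(1)] tangent_space_normal[OF chart_in_S] by blast
  then obtain h where "u = X h y" unfolding X_def by blast
  with basis[of h] show ?thesis using X_linear[OF assms(1)] by metis
qed

lemma W_eq: "snd z \<in> U \<Longrightarrow> W z = X (a + fst z *\<^sub>R b) (snd z)"
  using X_linear[of "snd z" 1 a "fst z" b] by (simp add: W_def)

lemma direction_parameter_nonzero: "a + s *\<^sub>R b \<noteq> 0"
  using independent[of 1 s] by auto

lemma W_nonzero: "snd z \<in> U \<Longrightarrow> W z \<noteq> 0"
  using X_eq_0 W_eq direction_parameter_nonzero by metis

lemma direction:
  assumes "snd z \<in> U"
  shows "norm (direction z) = 1" "direction z \<in> tangent_space S (\<phi> (snd z))"
proof -
  show "norm (direction z) = 1" using W_nonzero[OF assms] by (simp add: direction_def)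
  have "normal (\<phi> (snd z)) \<bullet> W z = 0"
    using X_tangent[OF assms] normal(2)[OF chart_in_S[OF assms]] W_eq[OF assms] by metis
  then show "direction z \<in> tangent_space S (\<phi> (snd z))"
    unfolding tangent_space_normal[OF chart_in_S[OF assms]] by (simp add: direction_def)
qed

lemma \<Psi>_in_H:
  assumes "snd z \<in> U"
  shows "\<Psi> z \<in> H" "touch (\<Psi> z) = \<phi> (snd z)"
  using direction[OF assms] chart_in_S[OF assms] touch_eqI unfolding \<Psi>_def H_iff by blast+

lemma open_domain: "open (UNIV \<times> U)"
  using chartD(1) by (simp add: open_Times)

lemma smooth:
  "smooth_on W (UNIV \<times> U)" "smooth_on (\<lambda>z. inverse (norm (W z))) (UNIV \<times> U)"
  "smooth_on direction (UNIV \<times> U)" "smooth_on \<Psi> (UNIV \<times> U)"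
proof -
  note o = open_domain
  have snd: "smooth_on (\<lambda>z. f (snd z)) (UNIV \<times> U)" if "smooth_on f U" for f :: "real \<times> real \<Rightarrow> real^3"
    by (rule smooth_on_compose_linear[OF chartD(1) bounded_linear_snd _ o that]) auto
  have X: "smooth_on (\<lambda>z. X c (snd z)) (UNIV \<times> U)" for c
    unfolding X_def by (rule snd[OF smooth_on_derivative[OF chartD(2)]])
  show W: "smooth_on W (UNIV \<times> U)"
    unfolding W_def[abs_def]
    by (intro smooth_on_add[OF o] smooth_on_bilinear[OF o bounded_bilinear_scaleR]
        smooth_on_linear[OF o bounded_linear_fst] X)
  show i: "smooth_on (\<lambda>z. inverse (norm (W z))) (UNIV \<times> U)"
    by (rule smooth_on_inverse_norm[OF o _ W], rule W_nonzero) (simp add: mem_Times_iff)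
  show u: "smooth_on direction (UNIV \<times> U)"
    unfolding direction_def[abs_def] by (rule smooth_on_bilinear[OF o bounded_bilinear_scaleR i W])
  show "smooth_on \<Psi> (UNIV \<times> U)"
    unfolding \<Psi>_def[abs_def]
    by (intro smooth_on_Pair[OF o] smooth_on_diff[OF o] smooth_on_bilinear[OF o bounded_bilinear_scaleR]
        smooth_on_bilinear[OF o bounded_bilinear_inner] u snd chartD(2))
qed

text \<open>A variation that fixes the line \<open>\<Psi> z\<close> to first order moves the point of tangency
  along the line.  The direction of the line being fixed, the second fundamental form vanishes on that
  variation of the point of tangency, which is therefore zero.\<close>

lemma inj_derivative:
  assumes z: "z \<in> UNIV \<times> U"
  shows "inj (frechet_derivative \<Psi> (at z))"
proof -
  obtain s y where zs: "z = (s, y)" and y: "y \<in> U" using z by auto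
  define i where "i z = inverse (norm (W z))" for z
  define D where "D c = frechet_derivative (\<lambda>y. X c y) (at y)" for c
  define i' where "i' = frechet_derivative i (at z)"
  define W' where "W' h = D a (snd h) + (fst h *\<^sub>R X b y + s *\<^sub>R D b (snd h))" for h
  define u' where "u' h = i z *\<^sub>R W' h + i' h *\<^sub>R W z" for h
  define P where "P h = X (snd h) y" for h :: "real \<times> real \<times> real"
  have D: "(X c has_derivative D c) (at y)" for c
    unfolding D_def X_def by (rule smooth_on_has_derivative[OF smooth_on_derivative[OF chartD(2)] y])
  have at_snd: "((\<lambda>z. f (snd z)) has_derivative (\<lambda>h. f' (snd h))) (at z)"
    if "(f has_derivative f') (at y)" for f :: "real \<times> real \<Rightarrow> real^3" and f'
    using has_derivative_compose[OF has_derivative_snd[OF has_derivative_ident], of f f' z UNIV] that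
    by (simp add: zs)
  have W': "(W has_derivative W') (at z)"
    unfolding W_def[abs_def] W'_def[abs_def]
    by (rule derivative_eq_intros at_snd D refl)+ (simp add: zs add_ac)
  have i': "(i has_derivative i') (at z)"
    unfolding i'_def i_def[abs_def] by (rule smooth_on_has_derivative[OF smooth(2) z])
  have u': "(direction has_derivative u') (at z)"
    unfolding direction_def[abs_def] u'_def[abs_def] i_def[abs_def, symmetric]
    using has_derivative_scaleR[OF i' W'] by (simp add: i_def[abs_def])
  have P: "((\<lambda>z. \<phi> (snd z)) has_derivative P) (at z)"
    unfolding P_def[abs_def] X_def by (rule at_snd[OF chartD(7)[OF y]])
  have "(\<Psi> has_derivative (\<lambda>h. (u' h, P h - ((\<phi> y \<bullet> direction z) *\<^sub>R u' h
      + (\<phi> y \<bullet> u' h + P h \<bullet> direction z) *\<^sub>R direction z)))) (at z)"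
    unfolding \<Psi>_def[abs_def]
    by (rule derivative_eq_intros u' P refl)+ (simp add: zs)
  note \<Psi>' = frechet_derivative_at[OF this, symmetric] and lin = has_derivative_linear[OF this]
  show ?thesis
    unfolding \<Psi>' linear_injective_0[OF lin] prod.inject zero_prod_def
  proof (intro allI impI)
    fix h
    assume h: "u' h = 0 \<and> P h - ((\<phi> y \<bullet> direction z) *\<^sub>R u' h
      + (\<phi> y \<bullet> u' h + P h \<bullet> direction z) *\<^sub>R direction z) = 0"
    define c where "c = a + s *\<^sub>R b"
    have c: "c \<noteq> 0" unfolding c_def by (rule direction_parameter_nonzero)
    have i: "i z \<noteq> 0" using W_nonzero[of z] y by (simp add: i_def zs)
    have Wz: "W z = X c y" using W_eq[of z] y by (simp add: zs c_def)
    define \<mu> where "\<mu> = (P h \<bullet> direction z) * i z"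
    have "P h = (P h \<bullet> direction z) *\<^sub>R direction z"
      using conjunct2[OF h] unfolding conjunct1[OF h] by simp
    also have "\<dots> = \<mu> *\<^sub>R W z"
      by (simp add: \<mu>_def direction_def[of z] i_def)
    also have "\<dots> = X (\<mu> *\<^sub>R c) y" using X_linear[OF y, of \<mu> c 0 c] by (simp add: Wz)
    finally have dy: "snd h = \<mu> *\<^sub>R c" unfolding P_def by (rule X_inj[OF y])
    let ?n = "normal (\<phi> y)"
    have n: "?n \<bullet> X d y = 0" for d
      using normal(2)[OF chart_in_S[OF y] X_tangent[OF y]] .
    have "?n \<bullet> u' h = 0" using h by simp
    then have "?n \<bullet> W' h = 0"
      unfolding u'_def using i by (simp add: inner_add_right Wz n)
    moreover have W'h: "W' h = \<mu> *\<^sub>R D c c + fst h *\<^sub>R X b y"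
    proof -
      have "D c k = D a k + s *\<^sub>R D b k" for k
        using second_derivative_linear[OF chartD(1,2) y, of 1 a s b k] by (simp add: D_def X_def c_def)
      moreover have "D c (\<mu> *\<^sub>R c) = \<mu> *\<^sub>R D c c"
        using linear_scale[OF has_derivative_linear[OF D]] .
      ultimately show ?thesis unfolding W'_def dy by (simp add: add_ac)
    qed
    ultimately have "\<mu> * (?n \<bullet> D c c) = 0"
      by (simp add: inner_add_right n)
    moreover have "?n \<bullet> D c c > 0"
      unfolding D_def X_def using normal(3)[OF chart_in_S[OF y] chart y refl c] .
    ultimately have \<mu>: "\<mu> = 0" by simp
    have "W' h = fst h *\<^sub>R X b y" using W'h \<mu> by simp
    then have "0 = (i z * fst h) *\<^sub>R X b y + i' h *\<^sub>R (X a y + s *\<^sub>R X b y)"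
      using h unfolding u'_def W_def by (simp add: zs)
    also have "\<dots> = i' h *\<^sub>R X a y + (i z * fst h + i' h * s) *\<^sub>R X b y"
      by (simp add: algebra_simps)
    also have "\<dots> = X (i' h *\<^sub>R a + (i z * fst h + i' h * s) *\<^sub>R b) y"
      by (rule X_linear[OF y])
    finally have "i' h *\<^sub>R a + (i z * fst h + i' h * s) *\<^sub>R b = 0"
      using X_eq_0[OF y] by metis
    then have "fst h = 0" using independent i by fastforce
    then show "h = (0, 0, 0)" using dy \<mu> by (simp add: prod_eq_iff)
  qed
qed

definition N where "N y = cross3 (X a y) (X b y)"

lemma N_nonzero: "y \<in> U \<Longrightarrow> N y \<bullet> N y > 0"
proof -
  assume y: "y \<in> U"
  have "N y \<noteq> 0"
  proof
    assume "N y = 0"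
    then have "X a y = 0 \<or> X b y = 0 \<or> (\<exists>c. X b y = c *\<^sub>R X a y)"
      unfolding N_def cross_eq_0 collinear_lemma by blast
    moreover have "X a y \<noteq> 0" using X_eq_0[OF y] a by blast
    moreover have "X b y \<noteq> c *\<^sub>R X a y" for c
    proof
      assume "X b y = c *\<^sub>R X a y"
      then have "X ((- c) *\<^sub>R a + 1 *\<^sub>R b) y = 0"
        using X_linear[OF y, of "- c" a 1 b] by simp
      then show False using X_eq_0[OF y] independent[of "- c" 1] by fastforce
    qed
    moreover from this[of 0] have "X b y \<noteq> 0" by simp
    ultimately show False by blast
  qed
  then show ?thesis by simp
qed

text \<open>By Cramer's rule, \<open>coord_a\<close> and \<open>coord_b\<close> are the coordinates of a tangent vector with
  respect to \<open>X a\<close> and \<open>X b\<close>, up to a common positive factor.\<close>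

definition coord_a where "coord_a u y = cross3 u (X b y) \<bullet> N y"
definition coord_b where "coord_b u y = cross3 (X a y) u \<bullet> N y"

lemma coords:
  "coord_a (\<alpha> *\<^sub>R X a y + \<beta> *\<^sub>R X b y) y = \<alpha> * (N y \<bullet> N y)"
  "coord_b (\<alpha> *\<^sub>R X a y + \<beta> *\<^sub>R X b y) y = \<beta> * (N y \<bullet> N y)"
  by (simp_all add: coord_a_def coord_b_def N_def cross_add_left cross_add_right cross_mult_left
      cross_mult_right)

lemma \<Psi>_coords:
  assumes "y \<in> U"
  shows "coord_a (direction (s, y)) y > 0" "coord_b (direction (s, y)) y / coord_a (direction (s, y)) y = s"
proof -
  let ?i = "inverse (norm (W (s, y)))"
  have i: "?i > 0" using W_nonzero[of "(s, y)"] assms by simp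
  have "direction (s, y) = ?i *\<^sub>R X a y + (?i * s) *\<^sub>R X b y"
    by (simp add: direction_def W_def[of "(s, y)"] scaleR_add_right)
  then have *: "coord_a (direction (s, y)) y = ?i * (N y \<bullet> N y)"
    "coord_b (direction (s, y)) y = ?i * s * (N y \<bullet> N y)"
    using coords by metis+
  show "coord_a (direction (s, y)) y > 0" using i N_nonzero[OF assms] unfolding * by simp
  show "coord_b (direction (s, y)) y / coord_a (direction (s, y)) y = s"
    using i N_nonzero[OF assms] unfolding * by (simp add: field_simps)
qed

lemma \<Psi>_of_coords:
  assumes uv: "(u, v) \<in> H" and y: "y \<in> U" "touch (u, v) = \<phi> y" and pos: "coord_a u y > 0"
  shows "\<Psi> (coord_b u y / coord_a u y, y) = (u, v)"
proof -
  obtain \<alpha> \<beta> where u: "u = \<alpha> *\<^sub>R X a y + \<beta> *\<^sub>R X b y"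
    using tangent_eq_X[OF y(1)] touch(2)[OF uv] y(2) by metis
  have \<alpha>: "\<alpha> > 0" using pos N_nonzero[OF y(1)] unfolding u coords by (simp add: zero_less_mult_iff)
  have s: "coord_b u y / coord_a u y = \<beta> / \<alpha>"
    using N_nonzero[OF y(1)] unfolding u coords by simp
  have W: "W (\<beta> / \<alpha>, y) = inverse \<alpha> *\<^sub>R u"
    using \<alpha> by (simp add: W_def u scaleR_add_right divide_inverse mult.commute)
  have "norm u = 1" using uv unfolding H_iff by blast
  then have "direction (\<beta> / \<alpha>, y) = u" using \<alpha> unfolding direction_def W by simp
  then show ?thesis
    unfolding s \<Psi>_def using touch(3)[OF uv] y(2) by simp
qed

text \<open>The inverse of \<open>\<Psi>\<close> takes the point of tangency, which depends continuously on the line, to its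
  parameter \<open>y\<close>, and the direction to the quotient of its coordinates at \<open>y\<close>.  The image of \<open>\<Psi>\<close> is open because
  it is given by two open conditions: the point of tangency is in the image of \<open>\<phi>\<close>, and the
  first coordinate is positive.\<close>

lemma local_parametrization_\<Psi>: "local_parametrization \<Psi> (UNIV \<times> U) H"
proof -
  obtain \<psi> where \<psi>: "homeomorphism U (\<phi> ` U) \<phi> \<psi>" using chartD(5) by blast
  have \<psi>_eq: "\<psi> (\<phi> y) = y" if "y \<in> U" for y using \<psi> that unfolding homeomorphism_def by blast
  define H1 where "H1 = H \<inter> touch -` (\<phi> ` U)"
  have H1: "openin (top_of_set H) H1"
    unfolding H1_def using touch(1)
    by (intro continuous_openin_preimage[OF continuous_touch _ chartD(4)]) auto
  have cont_\<psi>: "continuous_on H1 (\<lambda>l. \<psi> (touch l))"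
  proof (rule continuous_on_compose2[where g = \<psi> and f = touch])
    show "continuous_on (\<phi> ` U) \<psi>" using \<psi> unfolding homeomorphism_def by blast
    show "continuous_on H1 touch" by (rule continuous_on_subset[OF continuous_touch]) (simp add: H1_def)
  qed (auto simp: H1_def)
  have \<psi>_U: "(\<lambda>l. \<psi> (touch l)) ` H1 \<subseteq> U" using \<psi>_eq by (auto simp: H1_def)
  have cont_X: "continuous_on H1 (\<lambda>l. X c (\<psi> (touch l)))" for c
    unfolding X_def using smooth_on_imp_continuous_on[OF smooth_on_derivative[OF chartD(2)]] cont_\<psi> \<psi>_U
    by (rule continuous_on_compose2)
  have cont: "continuous_on H1 (\<lambda>l. coord_a (fst l) (\<psi> (touch l)))"
    "continuous_on H1 (\<lambda>l. coord_b (fst l) (\<psi> (touch l)))"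
    unfolding coord_a_def coord_b_def N_def
    by (intro continuous_on_inner continuous_on_cross continuous_on_fst continuous_on_id cont_X)+
  define H2 where "H2 = H1 \<inter> (\<lambda>l. coord_a (fst l) (\<psi> (touch l))) -` {0<..}"
  have "openin (top_of_set H1) H2"
    unfolding H2_def using cont(1) by (intro continuous_openin_preimage_gen) auto
  then have H2: "openin (top_of_set H) H2" using H1 openin_trans by blast
  define \<Theta> where "\<Theta> l = (coord_b (fst l) (\<psi> (touch l)) / coord_a (fst l) (\<psi> (touch l)), \<psi> (touch l))" for l
  have to_H2: "\<Psi> z \<in> H2" and left: "\<Theta> (\<Psi> z) = z" if z: "z \<in> UNIV \<times> U" for z
  proof -
    obtain s y where zs: "z = (s, y)" and y: "y \<in> U" using z by auto
    have t: "touch (\<Psi> z) = \<phi> y" "\<Psi> z \<in> H" using \<Psi>_in_H[of z] y by (simp_all add: zs)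
    have f: "fst (\<Psi> z) = direction (s, y)" by (simp add: \<Psi>_def zs)
    show "\<Psi> z \<in> H2" using t y \<Psi>_coords(1)[OF y] by (auto simp: H2_def H1_def f \<psi>_eq)
    show "\<Theta> (\<Psi> z) = z" unfolding \<Theta>_def t f \<psi>_eq[OF y] \<Psi>_coords(2)[OF y] by (rule zs[symmetric])
  qed
  have to_U: "\<Theta> l \<in> UNIV \<times> U" and right: "\<Psi> (\<Theta> l) = l" if "l \<in> H2" for l
  proof -
    obtain u v y where l: "l = (u, v)" "(u, v) \<in> H" "y \<in> U" "touch (u, v) = \<phi> y"
      using \<open>l \<in> H2\<close> by (cases l) (auto simp: H2_def H1_def)
    have \<Theta>: "\<Theta> l = (coord_b u y / coord_a u y, y)" and pos: "coord_a u y > 0"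
      using \<open>l \<in> H2\<close> l by (simp_all add: \<Theta>_def H2_def \<psi>_eq)
    show "\<Theta> l \<in> UNIV \<times> U" "\<Psi> (\<Theta> l) = l"
      unfolding \<Theta> using l \<Psi>_of_coords[OF l(2-4) pos] by simp_all
  qed
  have img: "\<Psi> ` (UNIV \<times> U) = H2" using to_H2 to_U right by (metis image_subsetI rev_image_eqI subsetI subset_antisym)
  have "homeomorphism (UNIV \<times> U) H2 \<Psi> \<Theta>"
  proof (rule homeomorphismI)
    show "continuous_on (UNIV \<times> U) \<Psi>" by (rule smooth_on_imp_continuous_on[OF smooth(4)])
    have "H2 \<subseteq> H1" by (simp add: H2_def)
    then show "continuous_on H2 \<Theta>"
      unfolding \<Theta>_def[abs_def] using cont cont_\<psi>
      by (intro continuous_on_Pair continuous_on_divide) (auto intro: continuous_on_subset simp: H2_def)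
    show "\<Psi> ` (UNIV \<times> U) \<subseteq> H2" using to_H2 by blast
    show "\<Theta> ` H2 \<subseteq> UNIV \<times> U" using to_U by blast
  qed (use left right in blast)+
  then show ?thesis
    unfolding local_parametrization_def img
    using open_domain smooth(4) inj_derivative H2 by blast
qed

end


section \<open>The pencils of tangent lines\<close>

lemma great_circle_cos_sin:
  fixes a b :: "real^3"
  assumes "a \<bullet> a = 1" "b \<bullet> b = 1" "a \<bullet> b = 0"
  shows "great_circle (\<lambda>t. cos t *\<^sub>R a + sin t *\<^sub>R b) (\<lambda>t. - sin t *\<^sub>R a + cos t *\<^sub>R b)"
proof
  fix t :: real
  show "((\<lambda>t. cos t *\<^sub>R a + sin t *\<^sub>R b) has_vector_derivative - sin t *\<^sub>R a + cos t *\<^sub>R b) (at t)"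
    "((\<lambda>t. - sin t *\<^sub>R a + cos t *\<^sub>R b) has_vector_derivative - (cos t *\<^sub>R a + sin t *\<^sub>R b)) (at t)"
    by (auto intro!: derivative_eq_intros)
  have "b \<bullet> a = 0" using assms(3) by (simp add: inner_commute)
  then show "(cos t *\<^sub>R a + sin t *\<^sub>R b) \<bullet> (cos t *\<^sub>R a + sin t *\<^sub>R b) = 1"
    "(- sin t *\<^sub>R a + cos t *\<^sub>R b) \<bullet> (- sin t *\<^sub>R a + cos t *\<^sub>R b) = 1"
    "(cos t *\<^sub>R a + sin t *\<^sub>R b) \<bullet> (- sin t *\<^sub>R a + cos t *\<^sub>R b) = 0"
    using assms sin_cos_squared_add3[of t]
    by (simp_all add: inner_add_left inner_add_right algebra_simps)
qed

definition pencil :: "real^3 \<Rightarrow> (real \<Rightarrow> real^3) \<Rightarrow> real \<Rightarrow> (real^3) \<times> (real^3)" where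
  "pencil p w t = (w t, p - (p \<bullet> w t) *\<^sub>R w t)"

context great_circle
begin

lemma pencil_derivative:
  "(pencil p w has_vector_derivative (w' t, - ((p \<bullet> w' t) *\<^sub>R w t) - (p \<bullet> w t) *\<^sub>R w' t)) (at t)"
proof -
  have "((\<lambda>t. p \<bullet> w t) has_real_derivative p \<bullet> w' t) (at t)"
    unfolding has_real_derivative_iff_has_vector_derivative
    using bounded_linear.has_vector_derivative[OF bounded_linear_inner_right w] .
  then have "((\<lambda>t. p - (p \<bullet> w t) *\<^sub>R w t) has_vector_derivative
      - ((p \<bullet> w' t) *\<^sub>R w t) - (p \<bullet> w t) *\<^sub>R w' t) (at t)"
    by (auto intro!: derivative_eq_intros w simp: algebra_simps)
  then show ?thesis
    unfolding pencil_def[abs_def] by (rule has_vector_derivative_Pair[OF w])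
qed

lemma pencil_tangent:
  assumes "\<And>s. pencil p w s \<in> M"
  shows "(w' t, - ((p \<bullet> w' t) *\<^sub>R w t) - (p \<bullet> w t) *\<^sub>R w' t) \<in> tangent_space M (pencil p w t)"
proof -
  have "((\<lambda>s. pencil p w (t + s)) has_vector_derivative
      (w' t, - ((p \<bullet> w' t) *\<^sub>R w t) - (p \<bullet> w t) *\<^sub>R w' t)) (at 0)"
  proof -
    have "((\<lambda>s. t + s) has_vector_derivative 1) (at (0::real))"
      by (auto intro!: derivative_eq_intros)
    then show ?thesis
      using vector_diff_chain_at[of "\<lambda>s. t + s" 1 0 "pencil p w"] pencil_derivative[of p t]
      by (simp add: o_def)
  qed
  then show ?thesis
    using assms unfolding tangent_space_def by (intro CollectI exI[of _ "\<lambda>s. pencil p w (t + s)"]) simp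
qed

lemma pencil_in_oriented_lines: "pencil p w t \<in> oriented_lines"
  using orthonormal(1)[of t]
  by (simp add: pencil_def oriented_lines_def norm_eq_1 inner_diff_right inner_commute)

lemma pencil_velocity_null:
  fixes p t
  defines "V \<equiv> (w' t, - ((p \<bullet> w' t) *\<^sub>R w t) - (p \<bullet> w t) *\<^sub>R w' t)"
  shows "neutral_metric (pencil p w t) V V = 0"
proof -
  have V: "V \<in> tangent_space oriented_lines (pencil p w t)"
    unfolding V_def by (rule pencil_tangent[OF pencil_in_oriented_lines])
  have "x \<bullet> cross3 y (- (\<alpha> *\<^sub>R x) - \<beta> *\<^sub>R y) = 0" for x y :: "real^3" and \<alpha> \<beta>
    by (simp add: cross3_def inner_vec_def sum_3) algebra
  then show ?thesis
    using neutral_metric_triple_product[OF pencil_in_oriented_lines[unfolded pencil_def]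
        V[unfolded V_def pencil_def] V[unfolded V_def pencil_def]]
    unfolding V_def pencil_def by simp
qed

end

context convex_surface
begin

definition leaf where "leaf p = {(u, p - (p \<bullet> u) *\<^sub>R u) | u. norm u = 1 \<and> u \<in> tangent_space S p}"

lemma leaf_eq: "p \<in> S \<Longrightarrow> leaf p = {l \<in> H. touch l = p}"
proof (intro equalityI subsetI)
  assume p: "p \<in> S"
  fix l
  show "l \<in> {l \<in> H. touch l = p}" if "l \<in> leaf p"
    using that touch_eqI[OF p] p unfolding leaf_def by (auto simp: H_iff)
  show "l \<in> leaf p" if "l \<in> {l \<in> H. touch l = p}"
  proof -
    obtain u v where "l = (u, v)" by fastforce
    with that have l: "l = (u, v)" "(u, v) \<in> H" "touch (u, v) = p" by simp_all
    then show ?thesis using touch(2,3)[OF l(2)] H_iff[of u v] unfolding leaf_def l(3) by blast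
  qed
qed

text \<open>The sign of \<open>e\<close> is chosen so that \<open>u \<times> e\<close> is the normal of \<open>S\<close>, which is the vector that the
  metric pairs with velocities in \<open>null_normal\<close>.\<close>

lemma tangent_great_circle:
  assumes p: "p \<in> S" and u: "norm u = 1" "u \<in> tangent_space S p"
  defines "e \<equiv> cross3 (normal p) u"
  shows "great_circle (\<lambda>t. cos t *\<^sub>R u + sin t *\<^sub>R e) (\<lambda>t. - sin t *\<^sub>R u + cos t *\<^sub>R e)"
    and "cross3 u e = normal p"
    and "range (pencil p (\<lambda>t. cos t *\<^sub>R u + sin t *\<^sub>R e)) = leaf p"
proof -
  have n: "normal p \<bullet> normal p = 1" "normal p \<bullet> u = 0" "u \<bullet> normal p = 0" "u \<bullet> u = 1"
    using normal(1,2)[OF p] u by (simp_all add: norm_eq_1 inner_commute)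
  have ue: "u \<bullet> e = 0" "normal p \<bullet> e = 0" by (simp_all add: e_def dot_cross_self)
  have ee: "e \<bullet> e = 1"
    unfolding e_def dot_cross by (simp add: n)
  show gc: "great_circle (\<lambda>t. cos t *\<^sub>R u + sin t *\<^sub>R e) (\<lambda>t. - sin t *\<^sub>R u + cos t *\<^sub>R e)"
    by (rule great_circle_cos_sin[OF n(4) ee ue(1)])
  show uxe: "cross3 u e = normal p"
    unfolding e_def Lagrange by (simp add: n)
  interpret great_circle "\<lambda>t. cos t *\<^sub>R u + sin t *\<^sub>R e" "\<lambda>t. - sin t *\<^sub>R u + cos t *\<^sub>R e"
    by (rule gc)
  have T: "tangent_space S p = {v. normal p \<bullet> v = 0}" by (rule tangent_space_normal[OF p])
  show "range (pencil p (\<lambda>t. cos t *\<^sub>R u + sin t *\<^sub>R e)) = leaf p"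
  proof (intro equalityI subsetI)
    fix l assume "l \<in> range (pencil p (\<lambda>t. cos t *\<^sub>R u + sin t *\<^sub>R e))"
    then obtain t where "l = pencil p (\<lambda>t. cos t *\<^sub>R u + sin t *\<^sub>R e) t" by blast
    then show "l \<in> leaf p"
      using orthonormal(1)[of t] unfolding leaf_def T pencil_def
      by (intro CollectI exI[of _ "cos t *\<^sub>R u + sin t *\<^sub>R e"])
        (simp add: norm_eq_1 inner_add_right n ue)
  next
    fix l assume "l \<in> leaf p"
    then obtain d where l: "l = (d, p - (p \<bullet> d) *\<^sub>R d)" and d: "d \<bullet> d = 1" "d \<bullet> normal p = 0"
      unfolding leaf_def T by (auto simp: norm_eq_1 inner_commute)
    have dec: "d = (d \<bullet> u) *\<^sub>R u + (d \<bullet> e) *\<^sub>R e"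
      using frame_expansion[of d 0] d(2) by (simp add: uxe algebra_simps)
    have "d \<bullet> d = (d \<bullet> u) * (u \<bullet> d) + (d \<bullet> e) * (e \<bullet> d)"
      by (subst (2) dec) (simp add: inner_add_right inner_commute)
    then have "(d \<bullet> u)\<^sup>2 + (d \<bullet> e)\<^sup>2 = 1"
      using d(1) by (simp add: power2_eq_square inner_commute)
    then obtain t where t: "d \<bullet> u = cos t" "d \<bullet> e = sin t" using sincos_total_2pi by metis
    have "l = pencil p (\<lambda>t. cos t *\<^sub>R u + sin t *\<^sub>R e) t"
      using dec unfolding l pencil_def t by metis
    then show "l \<in> range (pencil p (\<lambda>t. cos t *\<^sub>R u + sin t *\<^sub>R e))" by blast
  qed
qed

lemma leaf_null_geodesic_circle:
  assumes p: "p \<in> S"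
  shows "null_geodesic_circle (leaf p)" "path_connected (leaf p)" "leaf p \<noteq> {}"
proof -
  obtain x where x: "x \<noteq> 0" "orthogonal (normal p) x"
    using orthogonal_to_vector_exists[of "normal p"] by auto
  define u where "u = x /\<^sub>R norm x"
  have u: "norm u = 1" "u \<in> tangent_space S p"
    using x unfolding tangent_space_normal[OF p] by (simp_all add: u_def orthogonal_def)
  define e where "e = cross3 (normal p) u"
  let ?w = "\<lambda>t. cos t *\<^sub>R u + sin t *\<^sub>R e" and ?w' = "\<lambda>t. - sin t *\<^sub>R u + cos t *\<^sub>R e"
  interpret great_circle ?w ?w'
    unfolding e_def by (rule tangent_great_circle[OF p u])
  have leaf: "leaf p = range (pencil p ?w)"
    unfolding e_def using tangent_great_circle(3)[OF p u] by simp
  have v: "vector_derivative (pencil p ?w) (at t)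
      = (?w' t, - ((p \<bullet> ?w' t) *\<^sub>R ?w t) - (p \<bullet> ?w t) *\<^sub>R ?w' t)" for t
    using pencil_derivative by (rule vector_derivative_at)
  show "leaf p \<noteq> {}" unfolding leaf by blast
  have "continuous_on UNIV (pencil p ?w)"
    using pencil_derivative has_vector_derivative_continuous by (blast intro: continuous_at_imp_continuous_on)
  then show "path_connected (leaf p)"
    unfolding leaf by (rule path_connected_continuous_image) (simp add: convex_imp_path_connected)
  show "null_geodesic_circle (leaf p)"
    unfolding null_geodesic_circle_def
  proof (intro exI conjI allI)
    show "line_geodesic (pencil p ?w)"
      unfolding pencil_def[abs_def] by (rule pencil_line_geodesic) unfold_locales
    fix t
    show "vector_derivative (pencil p ?w) (at t) \<noteq> 0"
      unfolding v using orthonormal(2)[of t] by (auto simp: zero_prod_def)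
    show "neutral_metric (pencil p ?w t) (vector_derivative (pencil p ?w) (at t))
        (vector_derivative (pencil p ?w) (at t)) = 0"
      unfolding v by (rule pencil_velocity_null)
    show "0 < 2 * pi" by simp
    show "pencil p ?w (t + 2 * pi) = pencil p ?w t"
      by (simp add: pencil_def)
    show "inj_on (pencil p ?w) {0..<2 * pi}"
    proof (rule inj_onI)
      fix s t assume st: "s \<in> {0..<2 * pi}" "t \<in> {0..<2 * pi}" "pencil p ?w s = pencil p ?w t"
      have ue: "u \<bullet> u = 1" "e \<bullet> e = 1" "u \<bullet> e = 0" "e \<bullet> u = 0"
        using orthonormal[of 0] by (simp_all add: inner_commute)
      from st(3) have "?w s \<bullet> u = ?w t \<bullet> u" "?w s \<bullet> e = ?w t \<bullet> e" by (simp_all add: pencil_def)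
      then have "sin s = sin t \<and> cos s = cos t" by (simp add: inner_add_left ue)
      then obtain n :: int where n: "s = t + 2 * pi * n" unfolding sin_cos_eq_iff by blast
      then have "\<bar>2 * pi * n\<bar> < 2 * pi * 1" using st(1,2) by auto
      then have "\<bar>real_of_int n\<bar> < 1" by (simp add: abs_mult)
      then show "s = t" using n by simp
    qed
    show "leaf p = range (pencil p ?w)" by (rule leaf)
  qed
qed

text \<open>The velocity of the pencil through \<open>p\<close> is normal to \<open>H\<close>: for a curve in \<open>H\<close>
  with velocity \<open>X = (u\<^sub>1, v\<^sub>1)\<close>, its product with \<open>X\<close> is a multiple of the component along
  the normal of \<open>S\<close> of \<open>v\<^sub>1 + (p \<bullet> u) u\<^sub>1\<close>, the velocity of a point that moves with the line and
  starts at \<open>p\<close>.  This point does not enter the body, so its velocity is tangent to \<open>S\<close>.\<close>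

lemma null_normal:
  assumes l: "l \<in> H"
  shows "\<exists>N\<in>tangent_space oriented_lines l. N \<noteq> 0 \<and>
    (\<forall>X\<in>tangent_space H l. neutral_metric l N X = 0) \<and> neutral_metric l N N = 0"
proof -
  obtain u v where luv: "l = (u, v)" by fastforce
  have uv: "(u, v) \<in> H" using l luv by simp
  define p where "p = touch (u, v)"
  note p = touch[OF uv, folded p_def]
  have u: "norm u = 1" using uv unfolding H_iff by blast
  then have uu: "u \<bullet> u = 1" by (simp add: norm_eq_1)
  define e where "e = cross3 (normal p) u"
  let ?w = "\<lambda>t. cos t *\<^sub>R u + sin t *\<^sub>R e" and ?w' = "\<lambda>t. - sin t *\<^sub>R u + cos t *\<^sub>R e"
  note tgc = tangent_great_circle[OF p(1) u p(2), folded e_def]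
  interpret great_circle ?w ?w' by (rule tgc)
  define N where "N = (e, - ((p \<bullet> e) *\<^sub>R u) - (p \<bullet> u) *\<^sub>R e)"
  have pencil_H: "pencil p ?w t \<in> H" for t
    using tgc(3) leaf_eq[OF p(1)] by blast
  have "pencil p ?w 0 = (u, v)" using p(3) by (simp add: pencil_def)
  then have NH: "N \<in> tangent_space H (u, v)"
    using pencil_tangent[of p H 0, OF pencil_H] by (simp add: N_def)
  have sub: "X \<in> tangent_space oriented_lines (u, v)" if "X \<in> tangent_space H (u, v)" for X
    using that H_subset unfolding tangent_space_def by (auto elim!: eventually_mono)
  have "e \<bullet> e = 1" using orthonormal(2)[of 0] by simp
  then have "N \<noteq> 0" by (auto simp: N_def zero_prod_def)
  moreover have null: "neutral_metric (u, v) N X = 0" if X: "X \<in> tangent_space H (u, v)" for X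
  proof -
    obtain u1 v1 where X1: "X = (u1, v1)" by fastforce
    obtain c where c: "c 0 = (u, v)" "\<forall>\<^sub>F t in nhds 0. c t \<in> H" "(c has_vector_derivative X) (at (0::real))"
      using X unfolding tangent_space_def by blast
    define z where "z t = snd (c t) + (p \<bullet> u) *\<^sub>R fst (c t)" for t
    define d where "d = v1 + (p \<bullet> u) *\<^sub>R u1"
    have "d \<in> tangent_space S p"
    proof (rule velocity_tangent_if_avoids_interior[OF p(1)])
      show "z 0 = p" using p(3) by (simp add: z_def c(1))
      have "bounded_linear (\<lambda>x :: (real^3) \<times> (real^3). snd x + (p \<bullet> u) *\<^sub>R fst x)"
        by (intro bounded_linear_intros)
      from bounded_linear.has_vector_derivative[OF this c(3)]
      show "(z has_vector_derivative d) (at 0)" by (simp add: z_def[abs_def] d_def X1)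
      show "\<forall>\<^sub>F t in nhds 0. z t \<notin> interior K"
        using c(2)
      proof eventually_elim
        case (elim t)
        then show ?case using line_avoids_interior[of "fst (c t)" "snd (c t)"] by (simp add: z_def)
      qed
    qed
    then have "normal p \<bullet> d = 0" using normal(2)[OF p(1)] by blast
    then have "cross3 u e \<bullet> d = 0" by (simp only: tgc(2))
    moreover have "neutral_metric (u, v) N X = - (cross3 u e \<bullet> d) / 4"
      unfolding X1 N_def
    proof (subst neutral_metric_triple_product)
      show "(u, v) \<in> oriented_lines" using uv H_subset by blast
      show "(e, - ((p \<bullet> e) *\<^sub>R u) - (p \<bullet> u) *\<^sub>R e) \<in> tangent_space oriented_lines (u, v)"
        "(u1, v1) \<in> tangent_space oriented_lines (u, v)"
        using sub[OF NH] sub[OF X] by (simp_all add: N_def X1)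
      show "- (u \<bullet> cross3 e v1 + u \<bullet> cross3 u1 (- ((p \<bullet> e) *\<^sub>R u) - (p \<bullet> u) *\<^sub>R e)) / 4
          = - (cross3 u e \<bullet> d) / 4"
        unfolding d_def by (simp add: cross3_def inner_vec_def sum_3) algebra
    qed
    ultimately show ?thesis by simp
  qed
  ultimately show ?thesis
    using sub[OF NH] null[OF NH] unfolding luv by blast
qed

text \<open>Take for \<open>a\<close> the parameter vector of the direction of the line; then the line has the parameter
  \<open>s = 0\<close>.\<close>

lemma foliated_chart_exists:
  assumes l: "l \<in> H"
  shows "\<exists>\<phi> U a. surface_chart S K \<phi> U a \<and> connected U \<and> l \<in> surface_chart.\<Psi> \<phi> a ` (UNIV \<times> U)"
proof -
  obtain u v where luv: "l = (u, v)" by fastforce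
  have uv: "(u, v) \<in> H" using l luv by simp
  define p where "p = touch (u, v)"
  note p = touch[OF uv, folded p_def]
  have u: "norm u = 1" using uv unfolding H_iff by blast
  obtain \<phi> :: "real \<times> real \<Rightarrow> real^3" and U0 x where \<phi>: "local_parametrization \<phi> U0 S" "x \<in> U0" "\<phi> x = p"
    using chart_at[OF p(1)] .
  obtain r where r: "r > 0" "ball x r \<subseteq> U0"
    using local_parametrizationD(1)[OF \<phi>(1)] \<phi>(2) open_contains_ball by blast
  have "u \<in> range (frechet_derivative \<phi> (at x))"
    using range_chart_derivative[OF \<phi>(1,2)] normal(2)[OF p(1,2)] \<phi>(3) by simp
  then obtain a where fa: "frechet_derivative \<phi> (at x) a = u" by blast
  have a0: "a \<noteq> 0"
  proof
    assume "a = 0"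
    then have "u = 0" using fa linear_0[OF has_derivative_linear[OF local_parametrizationD(7)[OF \<phi>(1,2)]]] by simp
    then show False using u by simp
  qed
  interpret surface_chart S K \<phi> "ball x r" a
    by unfold_locales (use local_parametrization_subset[OF \<phi>(1) open_ball r(2)] a0 in auto)
  have "direction (0, x) = u"
    using u fa by (simp add: direction_def W_def X_def)
  then have "\<Psi> (0, x) = l"
    using p(3) by (simp add: \<Psi>_def luv \<phi>(3))
  then have "l \<in> \<Psi> ` (UNIV \<times> ball x r)" using r(1) by (intro image_eqI[of _ _ "(0, x)"]) auto
  then show ?thesis using surface_chart_axioms connected_ball by blast
qed

text \<open>In the chart \<open>\<Psi>\<close> the leaf at \<open>p\<close> is the slice where \<open>\<phi> y = p\<close>, which is connected or empty.\<close>

lemma smooth_foliation_leaves: "smooth_foliation TYPE(real \<times> real \<times> real) H (leaf ` S)"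
  unfolding smooth_foliation_def
proof (intro conjI ballI)
  show "\<Union> (leaf ` S) = H"
  proof (intro equalityI subsetI)
    fix l assume "l \<in> H"
    moreover obtain u v where "l = (u, v)" by fastforce
    ultimately show "l \<in> \<Union> (leaf ` S)" using touch(1)[of u v] leaf_eq by auto
  qed (use leaf_eq in auto)
  show "disjoint (leaf ` S)"
    unfolding disjoint_def using leaf_eq by fastforce
  show "C \<noteq> {}" "path_connected C" if "C \<in> leaf ` S" for C
    using that leaf_null_geodesic_circle by auto
  fix l assume "l \<in> H"
  then obtain \<phi> U a where *: "surface_chart S K \<phi> U a" "connected U" "l \<in> surface_chart.\<Psi> \<phi> a ` (UNIV \<times> U)"
    using foliated_chart_exists by blast
  interpret surface_chart S K \<phi> U a by (rule *(1))
  have "components (C \<inter> \<Psi> ` (UNIV \<times> U)) \<subseteq> {\<Psi> ` (UNIV \<times> {y}) |y. y \<in> U}" if C: "C \<in> leaf ` S" for C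
  proof -
    obtain p where p: "p \<in> S" "C = leaf p" using C by blast
    have mem: "\<Psi> (s, y) \<in> C \<longleftrightarrow> \<phi> y = p" if "y \<in> U" for s y
      using \<Psi>_in_H[of "(s, y)"] that unfolding p(2) leaf_eq[OF p(1)] by simp
    show ?thesis
    proof (cases "p \<in> \<phi> ` U")
      case False
      then have "C \<inter> \<Psi> ` (UNIV \<times> U) = {}" using mem by auto
      then show ?thesis by simp
    next
      case True
      then obtain y where y: "y \<in> U" "\<phi> y = p" by blast
      have "inj_on \<phi> U" using chartD(5) unfolding homeomorphism_def by (metis inj_on_inverseI)
      then have unique: "y' = y" if "y' \<in> U" "\<phi> y' = p" for y'
        using that y unfolding inj_on_def by blast
      have "C \<inter> \<Psi> ` (UNIV \<times> U) = \<Psi> ` (UNIV \<times> {y})"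
      proof (intro equalityI subsetI)
        fix k assume k: "k \<in> C \<inter> \<Psi> ` (UNIV \<times> U)"
        then obtain s y' where *: "k = \<Psi> (s, y')" "y' \<in> U" by auto
        then have "y' = y" using k mem unique by simp
        then show "k \<in> \<Psi> ` (UNIV \<times> {y})" using * by simp
      qed (use mem y in auto)
      moreover have "connected (\<Psi> ` (UNIV \<times> {y}))"
      proof (rule connected_continuous_image)
        show "continuous_on (UNIV \<times> {y}) \<Psi>"
          by (rule continuous_on_subset[OF smooth_on_imp_continuous_on[OF smooth(4)]]) (use y in auto)
      qed (intro connected_Times connected_UNIV connected_sing)
      ultimately have "components (C \<inter> \<Psi> ` (UNIV \<times> U)) = {\<Psi> ` (UNIV \<times> {y})}"
        by (simp add: components_eq_sing_iff)
      then show ?thesis using y(1) by blast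
    qed
  qed
  then show "\<exists>(\<Phi> :: real \<times> real \<times> real \<Rightarrow> (real^3) \<times> (real^3)) A B.
      local_parametrization \<Phi> (A \<times> B) H \<and> connected A \<and> connected B \<and> l \<in> \<Phi> ` (A \<times> B) \<and>
      (\<forall>C\<in>leaf ` S. components (C \<inter> \<Phi> ` (A \<times> B)) \<subseteq> {\<Phi> ` (A \<times> {y}) |y. y \<in> B})"
    using local_parametrization_\<Psi> *(2,3) connected_UNIV by blast
qed

lemma null_hypersurface_H: "null_hypersurface H"
  unfolding null_hypersurface_def
proof (intro conjI ballI)
  show "smooth_submanifold TYPE(real \<times> real \<times> real) H"
    unfolding smooth_submanifold_def using smooth_foliation_leaves unfolding smooth_foliation_def by meson
qed (use H_subset null_normal in auto)

end

theorem proposition4: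
  fixes S :: "(real^3) set"
  assumes "smooth_submanifold TYPE(real \<times> real) S"
    and "compact S"
    and "strictly_convex_surface S"
  shows "null_hypersurface (tangent_hypersurface S) \<and>
    (\<exists>F. smooth_foliation TYPE(real \<times> real \<times> real) (tangent_hypersurface S) F \<and>
         (\<forall>C\<in>F. null_geodesic_circle C))"
proof -
  obtain K where K: "compact K" "convex K" "interior K \<noteq> {}" "S = frontier K"
    using assms(3) unfolding strictly_convex_surface_def by blast
  interpret convex_surface S K
    by unfold_locales (use assms(1,3) K in \<open>simp_all add: strictly_convex_surface_def\<close>)
  show ?thesis
    using null_hypersurface_H smooth_foliation_leaves leaf_null_geodesic_circle(1) by blast
qed

end
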